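(* Let the immersion $X\in C^3(B,\mathbb R^3)$ represent a geodesic disc $\mathfrak B_r(X_0)$ of radius $r>0$ and center $X_0$, with geodesic polar coordinates $(\varrho,\varphi)\in[0,r]\times[0,2\pi]$ in which the area element is $\sqrt{P(\varrho,\varphi)}\,d\varrho\,d\varphi$. Let its Gaussian curvature satisfy $$K(\varrho,\varphi)\le K_0\quad\text{for all }(\varrho,\varphi)\in[0,r]\times[0,2\pi]$$ with a real constant $K_0\in[0,+\infty)$. Then $$\mathcal A[X]\le r^2\left\{\pi+\frac12\int_0^r\int_0^{2\pi}\big\{K_0-K(\varrho,\varphi)\big\}\sqrt{P(\varrho,\varphi)}\,d\varphi\,d\varrho\right\}.$$
   Context: $B=\{(u,v)\in\mathbb R^2: u^2+v^2\le 1\}$. An immersion $X\in C^3(B,\mathbb R^3)$ has $\mathrm{rank}\,\partial X=2$ in $B$. Its area is $\mathcal A[X]=\iint_B|X_u\times X_v|\,du\,dv$, and $K$ is its Gaussian curvature. Geodesic disc: $X$ represents a geodesic disc $\mathfrak B_r(X_0)$ of radius $r$ and center $X_0$ if the whole surface, with the metric induced from $\mathbb R^3$, is described by geodesic polar coordinates $(\varrho,\varphi)\in[0,r]\times[0,2\pi]$ around $X_0$. In these coordinates the metric is $d\varrho^2+P(\varrho,\varphi)\,d\varphi^2$ with $P>0$ on $(0,r]\times[0,2\pi)$, $\lim_{\varrho\to0_+}P(\varrho,\varphi)=0$ and $\lim_{\varrho\to0_+}\frac{\partial}{\partial\varrho}\sqrt{P(\varrho,\varphi)}=1$. The boundary of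 the surface is the curve $\varrho=r$. *)

theory Defs
  imports "HOL-Analysis.Analysis"
begin

(* Derivatives are taken within the domain S. All sets S used below are convex with nonempty
   interior, so that they are unique also at boundary points, where they are one-sided. *)

definition dir_deriv ::
    "'a::euclidean_space set \<Rightarrow> 'a \<Rightarrow> ('a \<Rightarrow> 'b::real_normed_vector) \<Rightarrow> 'a \<Rightarrow> 'b" where
  "dir_deriv S v f x = frechet_derivative f (at x within S) v"

primrec C_k_on ::
    "nat \<Rightarrow> 'a::euclidean_space set \<Rightarrow> ('a \<Rightarrow> 'b::real_normed_vector) \<Rightarrow> bool" where
  "C_k_on 0 S f \<longleftrightarrow> continuous_on S f"
| "C_k_on (Suc k) S f \<longleftrightarrow> f differentiable_on S \<and> (\<forall>v. C_k_on k S (dir_deriv S v f))"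

definition unit_disc :: "(real^2) set" where
  "unit_disc = cball 0 1"

definition D_u :: "(real^2 \<Rightarrow> 'b::real_normed_vector) \<Rightarrow> real^2 \<Rightarrow> 'b" where
  "D_u = dir_deriv unit_disc (axis 1 1)"

definition D_v :: "(real^2 \<Rightarrow> 'b::real_normed_vector) \<Rightarrow> real^2 \<Rightarrow> 'b" where
  "D_v = dir_deriv unit_disc (axis 2 1)"

definition immersion :: "(real^2 \<Rightarrow> real^3) \<Rightarrow> bool" where
  "immersion X \<longleftrightarrow> (\<forall>p\<in>unit_disc. rank (jacobian X (at p within unit_disc)) = 2)"

definition surface_area :: "(real^2 \<Rightarrow> real^3) \<Rightarrow> real" where
  "surface_area X = integral unit_disc (\<lambda>p. norm (cross3 (D_u X p) (D_v X p)))"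

definition unit_normal :: "(real^2 \<Rightarrow> real^3) \<Rightarrow> real^2 \<Rightarrow> real^3" where
  "unit_normal X p = sgn (cross3 (D_u X p) (D_v X p))"

definition gauss_curvature :: "(real^2 \<Rightarrow> real^3) \<Rightarrow> real^2 \<Rightarrow> real" where
  "gauss_curvature X p =
     ((D_u (D_u X) p \<bullet> unit_normal X p) * (D_v (D_v X) p \<bullet> unit_normal X p)
        - (D_v (D_u X) p \<bullet> unit_normal X p)\<^sup>2) /
     ((D_u X p \<bullet> D_u X p) * (D_v X p \<bullet> D_v X p) - (D_u X p \<bullet> D_v X p)\<^sup>2)"

(* The acceleration in space is normal to the surface, i.e. the covariant acceleration vanishes. *)
definition geodesic_on :: "(real^2 \<Rightarrow> real^3) \<Rightarrow> real set \<Rightarrow> (real \<Rightarrow> real^2) \<Rightarrow> bool" where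
  "geodesic_on X I \<gamma> \<longleftrightarrow>
     (\<exists>v a. \<forall>t\<in>I. \<gamma> t \<in> unit_disc
        \<and> ((\<lambda>s. X (\<gamma> s)) has_vector_derivative v t) (at t within I)
        \<and> (v has_vector_derivative a t) (at t within I)
        \<and> (\<forall>w. a t \<bullet> dir_deriv unit_disc w X (\<gamma> t) = 0))"

(* Psi maps the coordinates (rho, phi) to the parameter domain. As X need not be injective, the
   centre is a point p of the parameter domain with X p = X0.
   Regularity: for X of class C^3 the geodesic flow is in general only of class C^1, so Psi and
   its radial derivative are required to be C^1 and nothing more. *)
definition geodesic_polar_coords ::
    "(real^2 \<Rightarrow> real^3) \<Rightarrow> real \<Rightarrow> real^3 \<Rightarrow> (real \<times> real \<Rightarrow> real^2) \<Rightarrow> (real \<Rightarrow> real \<Rightarrow> real) \<Rightarrow> bool"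
  where
  "geodesic_polar_coords X r X0 \<Psi> P \<longleftrightarrow>
     (let D = {0<..r} \<times> {0..2*pi};
          Y_rho = dir_deriv D (1, 0) (X \<circ> \<Psi>);
          Y_phi = dir_deriv D (0, 1) (X \<circ> \<Psi>)
      in
        (\<exists>p\<in>unit_disc. X p = X0
           \<and> (\<forall>\<phi>\<in>{0..2*pi}. \<Psi> (0, \<phi>) = p)
           \<and> bij_betw \<Psi> ({0<..r} \<times> {0..<2*pi}) (unit_disc - {p}))
        \<and> (\<forall>\<rho>\<in>{0..r}. \<Psi> (\<rho>, 2*pi) = \<Psi> (\<rho>, 0))
        \<and> \<Psi> ` ({r} \<times> {0..2*pi}) = frontier unit_disc
        \<and> continuous_on ({0..r} \<times> {0..2*pi}) \<Psi>
        \<and> C_k_on 1 D \<Psi> \<and> C_k_on 1 D (dir_deriv D (1, 0) \<Psi>)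
        \<and> (\<forall>\<phi>\<in>{0..2*pi}. geodesic_on X {0..r} (\<lambda>\<rho>. \<Psi> (\<rho>, \<phi>)))
        \<and> (\<forall>\<rho>\<in>{0<..r}. \<forall>\<phi>\<in>{0..2*pi}.
             Y_rho (\<rho>, \<phi>) \<bullet> Y_rho (\<rho>, \<phi>) = 1
             \<and> Y_rho (\<rho>, \<phi>) \<bullet> Y_phi (\<rho>, \<phi>) = 0
             \<and> Y_phi (\<rho>, \<phi>) \<bullet> Y_phi (\<rho>, \<phi>) = P \<rho> \<phi>)
        \<and> (\<forall>\<rho>\<in>{0<..r}. \<forall>\<phi>\<in>{0..<2*pi}. P \<rho> \<phi> > 0)
        \<and> (\<forall>\<phi>\<in>{0..<2*pi}.
             ((\<lambda>\<rho>. P \<rho> \<phi>) \<longlongrightarrow> 0) (at_right 0)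
             \<and> (deriv (\<lambda>\<rho>. sqrt (P \<rho> \<phi>)) \<longlongrightarrow> 1) (at_right 0)))"

end

theory Submission
  imports Defs
begin

text \<open>In geodesic polar coordinates the area density \<open>s = sqrt P\<close> satisfies, along every radial
geodesic, the Jacobi equation \<open>s'' = - K s\<close> with \<open>s = 0\<close> and \<open>s' = 1\<close> at the centre. Taylor's
formula with integral remainder, integrated once more over \<open>[0, r]\<close>, gives
\<open>\<integral>s dt = r\<^sup>2/2 - \<integral>(r - t)\<^sup>2/2 K s dt\<close>. Since \<open>-K \<le> K0 - K\<close>, \<open>0 \<le> K0 - K\<close> and
\<open>(r - t)\<^sup>2 \<le> r\<^sup>2\<close>, the remainder is at most \<open>r\<^sup>2/2 \<integral>(K0 - K) s dt\<close>, and integrating over the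
angle gives the claim, the area being \<open>\<integral>\<integral>s\<close> by change of variables.

The work lies in the Jacobi equation under the weak regularity of the coordinates, which excludes
taking two radial derivatives of \<open>P\<close> through third derivatives of \<open>\<Psi>\<close>. With the unit radial
field \<open>T\<close> and the unit normal \<open>n\<close>, the signed density is \<open>f = n \<bullet> (T \<times> Y\<^sub>\<phi>)\<close> for \<open>Y = X \<circ> \<Psi>\<close>.
The geodesic equation says that \<open>T\<^sub>\<rho>\<close> is a multiple of \<open>n\<close>; this multiple can be expressed by
first and second derivatives of \<open>X\<close> and by \<open>\<Psi>\<^sub>\<rho>\<close>, and is therefore of class \<open>C\<^sup>1\<close>. So
the mixed derivatives that occur may be exchanged (\<open>mixed_partial_swap\<close>), and one finds
\<open>f\<^sub>\<rho>\<^sub>\<rho> = - n \<bullet> (n\<^sub>\<rho> \<times> n\<^sub>\<phi>)\<close> (\<open>jacobi_equation_frame\<close>). The Gauss map multiplies oriented area by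
\<open>K\<close> (\<open>unit_normal_derivative\<close>), so the right-hand side is \<open>- K f\<close> (\<open>polar_jacobi_field\<close>).

All integrals are taken over a closed rectangle, including the singular edge \<open>\<rho> = 0\<close>. The density
extends continuously to that edge because \<open>s \<le> C \<rho>\<close> uniformly in the angle, which is an energy
estimate for the Jacobi equation (\<open>jacobi_equation_bound\<close>).\<close>

section \<open>Continuously differentiable maps\<close>

text \<open>The derivative is carried along as an explicit map, since \<open>frechet_derivative\<close> is a choice: relative
to a set it need not be determined, and its values on compound maps would be awkward to compute.
Continuity is asked direction by direction, which in finite dimension is continuity of the derivative.\<close>

definition has_C1_derivative ::
    "('a::euclidean_space \<Rightarrow> 'b::real_normed_vector) \<Rightarrow> ('a \<Rightarrow> 'a \<Rightarrow> 'b) \<Rightarrow> 'a set \<Rightarrow> bool" where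
  "has_C1_derivative F F' S \<longleftrightarrow>
     (\<forall>x\<in>S. (F has_derivative F' x) (at x within S)) \<and> (\<forall>v. continuous_on S (\<lambda>x. F' x v))"

lemma has_C1_derivativeD:
  assumes "has_C1_derivative F F' S"
  shows "x \<in> S \<Longrightarrow> (F has_derivative F' x) (at x within S)"
    and "continuous_on S (\<lambda>x. F' x v)"
    and "continuous_on S F"
  using assms unfolding has_C1_derivative_def
  by (auto intro!: has_derivative_continuous_on)

lemma has_C1_derivative_bounded_linear:
  assumes "bounded_linear L" "has_C1_derivative F F' S"
  shows "has_C1_derivative (\<lambda>x. L (F x)) (\<lambda>x v. L (F' x v)) S"
  unfolding has_C1_derivative_def
  by (intro conjI ballI allI bounded_linear.has_derivative[OF assms(1)]
      bounded_linear.continuous_on[OF assms(1)] has_C1_derivativeD[OF assms(2)])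

lemma has_C1_derivative_add:
  assumes "has_C1_derivative F F' S" "has_C1_derivative G G' S"
  shows "has_C1_derivative (\<lambda>x. F x + G x) (\<lambda>x v. F' x v + G' x v) S"
  using assms unfolding has_C1_derivative_def
  by (auto intro!: has_derivative_add continuous_on_add)

lemma has_C1_derivative_bilinear:
  assumes "bounded_bilinear B" "has_C1_derivative F F' S" "has_C1_derivative G G' S"
  shows "has_C1_derivative (\<lambda>x. B (F x) (G x)) (\<lambda>x v. B (F x) (G' x v) + B (F' x v) (G x)) S"
  unfolding has_C1_derivative_def
  by (intro conjI ballI allI continuous_on_add bounded_bilinear.FDERIV[OF assms(1)]
      bounded_bilinear.continuous_on[OF assms(1)]
      has_C1_derivativeD[OF assms(2)] has_C1_derivativeD[OF assms(3)])

lemma has_C1_derivative_compose: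
  fixes F :: "'a::euclidean_space \<Rightarrow> 'b::euclidean_space"
  assumes G: "has_C1_derivative G G' T" and F: "has_C1_derivative F F' S" and sub: "F ` S \<subseteq> T"
  shows "has_C1_derivative (\<lambda>x. G (F x)) (\<lambda>x v. G' (F x) (F' x v)) S"
proof -
  have der: "((\<lambda>x. G (F x)) has_derivative (\<lambda>v. G' (F x) (F' x v))) (at x within S)"
    if "x \<in> S" for x
    using has_derivative_in_compose2[OF has_C1_derivativeD(1)[OF G] sub that has_C1_derivativeD(1)[OF F that]]
    by auto
  have "G' (F x) w = (\<Sum>b\<in>Basis. (w \<bullet> b) *\<^sub>R G' (F x) b)" if "x \<in> S" for x w
  proof -
    interpret bounded_linear "G' (F x)"
      using has_derivative_bounded_linear has_C1_derivativeD(1)[OF G] that sub by blast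
    have "G' (F x) w = G' (F x) (\<Sum>b\<in>Basis. (w \<bullet> b) *\<^sub>R b)"
      by (simp add: euclidean_representation)
    then show ?thesis by (simp add: sum scaleR)
  qed
  then have "continuous_on S (\<lambda>x. G' (F x) (F' x v))
      \<longleftrightarrow> continuous_on S (\<lambda>x. \<Sum>b\<in>Basis. (F' x v \<bullet> b) *\<^sub>R G' (F x) b)" for v
    by (intro continuous_on_cong) auto
  moreover have "continuous_on S (\<lambda>x. \<Sum>b\<in>Basis. (F' x v \<bullet> b) *\<^sub>R G' (F x) b)" for v
    by (intro continuous_intros has_C1_derivativeD(2)[OF F]
        continuous_on_compose2[OF has_C1_derivativeD(2)[OF G] has_C1_derivativeD(3)[OF F] sub])
  ultimately show ?thesis
    using der unfolding has_C1_derivative_def by auto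
qed

text \<open>The unit normal is \<open>sgn\<close> of a cross product, so this is what makes it as smooth as the tangent vectors.\<close>

lemma has_C1_derivative_sgn:
  obtains g' where "has_C1_derivative (sgn :: 'a \<Rightarrow> 'a::euclidean_space) g' (- {0})"
proof -
  have norm: "has_C1_derivative norm (\<lambda>x v. sgn x \<bullet> v) (- {0::'a})"
    unfolding has_C1_derivative_def
  proof (intro conjI ballI allI)
    fix x :: 'a assume "x \<in> - {0}"
    then show "(norm has_derivative (\<lambda>v. sgn x \<bullet> v)) (at x within - {0})"
      using has_derivative_norm[of x] by (simp add: has_derivative_at_withinI inner_commute)
  next
    show "continuous_on (- {0}) (\<lambda>x::'a. sgn x \<bullet> v)" for v
      unfolding sgn_div_norm by (intro continuous_intros) auto
  qed
  have inv: "has_C1_derivative inverse (\<lambda>x v. - (inverse x * v * inverse x)) ({0<..} :: real set)"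
    unfolding has_C1_derivative_def
    by (intro conjI ballI allI has_derivative_inverse' continuous_intros) auto
  have id: "has_C1_derivative (\<lambda>x. x) (\<lambda>x v. v) (- {0::'a})"
    unfolding has_C1_derivative_def by (intro conjI ballI allI has_derivative_ident continuous_intros)
  have "has_C1_derivative (\<lambda>x. inverse (norm x)) 
      (\<lambda>x v. - (inverse (norm x) * (sgn x \<bullet> v) * inverse (norm x))) (- {0::'a})"
    by (rule has_C1_derivative_compose[OF inv norm]) auto
  from has_C1_derivative_bilinear[OF bounded_bilinear_scaleR this id]
  show thesis using that by (simp add: sgn_div_norm[abs_def])
qed

lemma C_k_on_SucD: "C_k_on (Suc k) S f \<Longrightarrow> C_k_on k S f"
proof (induction k arbitrary: f)
  case 0
  then show ?case by (simp add: differentiable_imp_continuous_on)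
next
  case (Suc k)
  then have "f differentiable_on S" "\<And>v. C_k_on (Suc k) S (dir_deriv S v f)"
    by auto
  then show ?case
    using Suc.IH by (simp del: C_k_on.simps(2) add: C_k_on.simps(2)[of k S f])
qed

lemma C_k_on_imp_has_C1_derivative:
  assumes "C_k_on (Suc k) S f"
  shows "has_C1_derivative f (\<lambda>x v. dir_deriv S v f x) S"
proof -
  have "C_k_on 1 S f"
    using assms
  proof (induction k)
    case (Suc k)
    then show ?case using C_k_on_SucD[OF Suc.prems] by simp
  qed simp
  then show ?thesis
    unfolding has_C1_derivative_def
    by (auto simp: dir_deriv_def[abs_def] differentiable_on_def frechet_derivative_works)
qed

section \<open>Interchanging mixed derivatives\<close>

text \<open>A form of Schwarz's theorem in which one mixed derivative is not assumed to exist. Writing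
\<open>F\<close> as the integral of its \<open>x\<close>-derivative \<open>G\<close> and differentiating under the integral gives
\<open>L x y = L a y + \<integral>H t y dt\<close>, from which the \<open>x\<close>-derivative of \<open>L\<close> can be read off.\<close>

lemma mixed_partial_swap:
  fixes F G L H :: "real \<Rightarrow> real \<Rightarrow> 'a::banach"
  assumes Fx: "\<And>x y. x \<in> {a..b} \<Longrightarrow> y \<in> {c..d} \<Longrightarrow>
             ((\<lambda>x. F x y) has_vector_derivative G x y) (at x within {a..b})"
    and Fy: "\<And>x y. x \<in> {a..b} \<Longrightarrow> y \<in> {c..d} \<Longrightarrow>
             (F x has_vector_derivative L x y) (at y within {c..d})"
    and Gy: "\<And>x y. x \<in> {a..b} \<Longrightarrow> y \<in> {c..d} \<Longrightarrow>
             (G x has_vector_derivative H x y) (at y within {c..d})"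
    and H: "continuous_on ({a..b} \<times> {c..d}) (\<lambda>(x, y). H x y)"
    and cont: "\<And>y. y \<in> {c..d} \<Longrightarrow> continuous_on {a..b} (\<lambda>x. G x y)"
    and "c < d" "x \<in> {a..b}" "y \<in> {c..d}"
  shows "((\<lambda>x. L x y) has_vector_derivative H x y) (at x within {a..b})"
proof -
  have "a \<le> b" using \<open>x \<in> _\<close> by auto
  have H': "continuous_on ({c..d} \<times> {a..b}) (\<lambda>(y, x). H x y)"
    unfolding split_beta
    by (rule continuous_on_compose2[OF H, unfolded split_beta,
        of "{c..d} \<times> {a..b}" "\<lambda>q. (snd q, fst q)", simplified])
       (auto intro!: continuous_intros)
  have Fint: "F x y = F a y + integral {a..x} (\<lambda>t. G t y)"
    if "x \<in> {a..b}" "y \<in> {c..d}" for x y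
  proof -
    have "((\<lambda>t. G t y) has_integral (F x y - F a y)) {a..x}"
      using that 
       by (intro fundamental_theorem_of_calculus has_vector_derivative_within_subset[OF Fx]) auto
    then show ?thesis by (simp add: integral_unique)
  qed
  have Lint: "L x y = L a y + integral {a..x} (\<lambda>t. H t y)" if x: "x \<in> {a..b}" for x
  proof -
    have "((\<lambda>y. integral (cbox a x) (\<lambda>t. G t y)) has_vector_derivative integral (cbox a x) (\<lambda>t. H t y))
        (at y within {c..d})"
    proof (rule leibniz_rule_vector_derivative)
      show "(\<lambda>t. G t y) integrable_on cbox a x" if "y \<in> {c..d}" for y
        using x that by (intro integrable_continuous continuous_on_subset[OF cont]) auto
      show "continuous_on ({c..d} \<times> cbox a x) (\<lambda>(y, t). H t y)"
        using x by (intro continuous_on_subset[OF H']) auto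
    qed (use x \<open>y \<in> _\<close> Gy in auto)
    then have "((\<lambda>y. F a y + integral (cbox a x) (\<lambda>t. G t y)) has_vector_derivative
        L a y + integral (cbox a x) (\<lambda>t. H t y)) (at y within {c..d})"
      using \<open>a \<le> b\<close> \<open>y \<in> _\<close> by (intro has_vector_derivative_add Fy) auto
    then have "(F x has_vector_derivative L a y + integral (cbox a x) (\<lambda>t. H t y)) (at y within {c..d})"
      by (rule has_vector_derivative_transform[rotated 2]) (use Fint[OF x] \<open>y \<in> _\<close> in auto)
    moreover have "(F x has_vector_derivative L x y) (at y within {c..d})"
      using x \<open>y \<in> _\<close> by (intro Fy)
    ultimately show ?thesis
      using vector_derivative_unique_within_closed_interval[of c d y "F x"] \<open>c < d\<close> \<open>y \<in> _\<close>
      by auto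
  qed
  have "continuous_on {a..b} (\<lambda>x. H x y)"
    by (rule continuous_on_compose2[OF H, of "{a..b}" "\<lambda>x. (x, y)", simplified])
       (use \<open>y \<in> _\<close> in \<open>auto intro!: continuous_on_Pair continuous_on_const continuous_on_id\<close>)
  from integral_has_vector_derivative[OF this \<open>x \<in> _\<close>]
  have "((\<lambda>x. L a y + integral {a..x} (\<lambda>t. H t y)) has_vector_derivative 0 + H x y) (at x within {a..b})"
    by (intro has_vector_derivative_add) auto
  then show ?thesis
    by (intro has_vector_derivative_transform[OF \<open>x \<in> _\<close> Lint]) auto
qed

section \<open>The Jacobi equation on an interval\<close>

lemma continuous_on_extend_left:
  fixes f :: "real \<Rightarrow> 'a::topological_space"
  assumes cont: "continuous_on {a<..b} f" and lim: "(f \<longlongrightarrow> L) (at_right a)"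
  shows "continuous_on {a..b} (\<lambda>t. if t = a then L else f t)" (is "continuous_on _ ?h")
  unfolding continuous_on_def
proof
  fix x assume x: "x \<in> {a..b}"
  have *: "(?h \<longlongrightarrow> l) (at x within A) \<longleftrightarrow> (f \<longlongrightarrow> l) (at x within A)" if "A \<subseteq> {a<..}" for A l
    using that by (intro filterlim_cong) (auto simp: eventually_at_filter)
  show "(?h \<longlongrightarrow> ?h x) (at x within {a..b})"
  proof (cases "x = a")
    case True
    have "(?h \<longlongrightarrow> L) (at_right a)"
      using lim *[of "{a<..}"] True by simp
    moreover have "at a within {a..b} \<le> at_right a"
      unfolding at_within_def by (intro inf_mono) auto
    ultimately show ?thesis
      unfolding True by (auto intro: tendsto_mono)
  next
    case False
    then have "at x within {a..b} = at x within {a<..b}"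
      using x by (intro at_within_nhd[of _ "{a<..}"]) auto
    then show ?thesis
      using cont x False *[of "{a<..b}" "f x"]
      by (simp add: continuous_on_def greaterThanAtMost_def)
  qed
qed

text \<open>The equation is tested against the weight \<open>(r - t)\<^sup>2/2\<close>: the function
\<open>(r - t)\<^sup>2/2 u + (r - t) s\<close> has derivative \<open>- s - (r - t)\<^sup>2/2 k s\<close>, the terms with \<open>u\<close>
cancelling, and runs from \<open>r\<^sup>2/2\<close> to \<open>0\<close>.\<close>

lemma jacobi_equation_integral:
  fixes s u k :: "real \<Rightarrow> real"
  assumes "r > 0"
    and ds: "\<And>t. 0 < t \<Longrightarrow> t < r \<Longrightarrow> (s has_real_derivative u t) (at t)"
    and du: "\<And>t. 0 < t \<Longrightarrow> t < r \<Longrightarrow> (u has_real_derivative - k t * s t) (at t)"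
    and cont: "continuous_on {0<..r} s" "continuous_on {0<..r} u"
    and lim: "(s \<longlongrightarrow> 0) (at_right 0)" "(u \<longlongrightarrow> 1) (at_right 0)"
  shows "((\<lambda>t. s t + (r - t)\<^sup>2 / 2 * (k t * s t)) has_integral r\<^sup>2 / 2) {0..r}"
proof -
  define h where "h t = (if t = 0 then r\<^sup>2 / 2 else (r - t)\<^sup>2 / 2 * u t + (r - t) * s t)" for t
  have "continuous_on {0<..r} (\<lambda>t. (r - t)\<^sup>2 / 2 * u t + (r - t) * s t)"
    by (intro continuous_intros cont) simp
  moreover have "((\<lambda>t. (r - t)\<^sup>2 / 2 * u t + (r - t) * s t) \<longlongrightarrow> (r - 0)\<^sup>2 / 2 * 1 + (r - 0) * 0) (at_right 0)"
    by (intro tendsto_intros lim) simp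
  ultimately have conth: "continuous_on {0..r} h"
    unfolding h_def by (intro continuous_on_extend_left) simp_all
  have "((\<lambda>t. - (s t + (r - t)\<^sup>2 / 2 * (k t * s t))) has_integral h r - h 0) {0..r}"
  proof (rule fundamental_theorem_of_calculus_interior)
    fix t assume t: "t \<in> {0<..<r}"
    have "((\<lambda>t. (r - t)\<^sup>2 / 2 * u t + (r - t) * s t) has_real_derivative
        - (s t + (r - t)\<^sup>2 / 2 * (k t * s t))) (at t)"
      using t by (auto intro!: derivative_eq_intros ds du simp: field_simps power2_eq_square)
    then have "(h has_real_derivative - (s t + (r - t)\<^sup>2 / 2 * (k t * s t))) (at t)"
      by (rule has_field_derivative_transform_within_open[of _ _ _ "{0<..}"])
         (use t in \<open>auto simp: h_def\<close>)
    then show "(h has_vector_derivative - (s t + (r - t)\<^sup>2 / 2 * (k t * s t))) (at t)"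
      by (simp add: has_real_derivative_iff_has_vector_derivative)
  qed (use \<open>r > 0\<close> conth in auto)
  from has_integral_neg[OF this] show ?thesis
    using \<open>r > 0\<close> by (simp add: h_def add.commute)
qed

text \<open>Gronwall's argument for the energy \<open>s\<^sup>2 + u\<^sup>2\<close>: its derivative \<open>2 (1 - k) s u\<close> is at most \<open>1 + M\<close>
times the energy, and its limit at \<open>0\<close> is \<open>1\<close>. The constant depends on \<open>k\<close> through \<open>M\<close> only, so the
bound is uniform over families of equations.\<close>

lemma jacobi_equation_bound:
  fixes s u k :: "real \<Rightarrow> real"
  assumes "r > 0"
    and ds: "\<And>t. 0 < t \<Longrightarrow> t < r \<Longrightarrow> (s has_real_derivative u t) (at t)"
    and du: "\<And>t. 0 < t \<Longrightarrow> t < r \<Longrightarrow> (u has_real_derivative - k t * s t) (at t)"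
    and cont: "continuous_on {0<..r} s" "continuous_on {0<..r} u"
    and lim: "(s \<longlongrightarrow> 0) (at_right 0)" "(u \<longlongrightarrow> 1) (at_right 0)"
    and k: "\<And>t. 0 < t \<Longrightarrow> t < r \<Longrightarrow> \<bar>k t\<bar> \<le> M"
    and t: "0 < t" "t \<le> r"
  shows "s t \<le> exp ((1 + M) * r) * t"
proof -
  define c where "c = 1 + M"
  have "\<bar>k (r/2)\<bar> \<le> M" using k[of "r/2"] \<open>r > 0\<close> by auto
  then have "c \<ge> 1" by (simp add: c_def)
  define E where "E t = exp (- c * t) * ((s t)\<^sup>2 + (u t)\<^sup>2)" for t
  have E_le: "E b \<le> E a" if "0 < a" "a \<le> b" "b < r" for a b
  proof (rule DERIV_nonpos_imp_nonincreasing[OF \<open>a \<le> b\<close>])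
    fix x assume x: "a \<le> x" "x \<le> b"
    then have x': "0 < x" "x < r" using that by auto
    have "(E has_real_derivative exp (- c * x) *
        (2 * (1 - k x) * (s x * u x) - c * ((s x)\<^sup>2 + (u x)\<^sup>2))) (at x)"
      unfolding E_def
      by (auto intro!: derivative_eq_intros ds[OF x'] du[OF x'] simp: algebra_simps power2_eq_square)
    moreover have "2 * (1 - k x) * (s x * u x) \<le> c * ((s x)\<^sup>2 + (u x)\<^sup>2)"
    proof -
      have "2 * \<bar>s x * u x\<bar> \<le> (s x)\<^sup>2 + (u x)\<^sup>2"
        using sum_squares_bound[of "\<bar>s x\<bar>" "\<bar>u x\<bar>"] by (simp add: abs_mult)
      moreover have "\<bar>1 - k x\<bar> \<le> c" using k[OF x'] by (simp add: c_def)
      ultimately have "\<bar>1 - k x\<bar> * (2 * \<bar>s x * u x\<bar>) \<le> c * ((s x)\<^sup>2 + (u x)\<^sup>2)"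
        by (intro mult_mono) auto
      moreover have "2 * (1 - k x) * (s x * u x) \<le> \<bar>1 - k x\<bar> * (2 * \<bar>s x * u x\<bar>)"
        using abs_ge_self[of "(1 - k x) * (s x * u x)"] unfolding abs_mult by linarith
      ultimately show ?thesis by linarith
    qed
    ultimately show "\<exists>y. (E has_real_derivative y) (at x) \<and> y \<le> 0"
      by (intro exI conjI) (auto simp: mult_nonneg_nonpos)
  qed
  have limE: "(E \<longlongrightarrow> exp (- c * 0) * (0\<^sup>2 + 1\<^sup>2)) (at_right 0)"
    unfolding E_def by (intro tendsto_intros lim)
  have E1: "E b \<le> 1" if "0 < b" "b < r" for b
  proof (rule tendsto_lowerbound)
    show "(E \<longlongrightarrow> 1) (at_right 0)" using limE by simp
    show "\<forall>\<^sub>F a in at_right 0. E b \<le> E a"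
      using that by (intro eventually_at_rightI[of 0 b] E_le) auto
  qed simp
  define C where "C = exp (c * r)"
  have "C \<ge> 1" using \<open>r > 0\<close> \<open>c \<ge> 1\<close> by (simp add: C_def)
  have uC: "u b \<le> C" if "0 < b" "b < r" for b
  proof -
    have "(s b)\<^sup>2 + (u b)\<^sup>2 = exp (c * b) * E b"
      by (simp add: E_def exp_minus field_simps)
    also have "\<dots> \<le> exp (c * b) * 1" using E1[OF that] by (intro mult_left_mono) auto
    also have "\<dots> \<le> C" using that \<open>c \<ge> 1\<close> by (simp add: C_def)
    finally have "(u b)\<^sup>2 \<le> C" by (smt (verit) zero_le_power2)
    \<comment> \<open>The energy bounds the square of \<open>u\<close>; because \<open>C \<ge>
      1\<close>, no square root of \<open>C\<close> is needed.\<close>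
    also have "C \<le> C\<^sup>2" using \<open>C \<ge> 1\<close> by (rule self_le_power) simp
    finally show ?thesis by (rule power2_le_imp_le) (use \<open>C \<ge> 1\<close> in simp)
  qed
  have "s t - C * t \<le> s a - C * a" if a: "0 < a" "a < t" for a
  proof (rule DERIV_nonpos_imp_decreasing_open[where f = "\<lambda>t. s t - C * t"])
    fix x assume "a < x" "x < t"
    then have x: "0 < x" "x < r" using a t by auto
    have "((\<lambda>t. s t - C * t) has_real_derivative u x - C) (at x)"
      by (auto intro!: derivative_eq_intros ds x)
    then show "\<exists>y. ((\<lambda>t. s t - C * t) has_real_derivative y) (at x) \<and> y \<le> 0"
      using uC[OF x] by (intro exI[of _ "u x - C"]) auto
  next
    show "continuous_on {a..t} (\<lambda>t. s t - C * t)"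
      by (intro continuous_intros continuous_on_subset[OF cont(1)]) (use a t in auto)
  qed (use a in auto)
  then have "s t - C * t \<le> 0 - C * 0"
    using eventually_at_rightI[of 0 t "\<lambda>a. s t - C * t \<le> s a - C * a"] t
    by (intro tendsto_lowerbound[of "\<lambda>a. s a - C * a" _ "at_right 0"] tendsto_intros lim) auto
  then show ?thesis by (simp add: C_def c_def)
qed

section \<open>Change of variables on a rectangle of polar coordinates\<close>

text \<open>Reading a pair as a vector of \<open>real^2\<close> maps boxes to boxes of the same content, so it preserves integrals.\<close>

lemma has_integral_vec2:
  fixes h :: "real \<times> real \<Rightarrow> 'b::real_normed_vector"
  assumes "(h has_integral I) (cbox (a, c) (b, d))"
  shows "((\<lambda>z::real^2. h (z $ 1, z $ 2)) has_integral I) {z. a \<le> z $ 1 \<and> z $ 1 \<le> b \<and> c \<le> z $ 2 \<and> z $ 2 \<le> d}"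
proof -
  define g where "g z = (z $ 1, z $ 2)" for z :: "real^2"
  define k where "k q = (vector [fst q, snd q] :: real^2)" for q :: "real \<times> real"
  have gk: "g (k q) = q" and kg: "k (g z) = z" for q z
    by (auto simp: g_def k_def vec_eq_iff forall_2)
  have gbox: "g ` cbox u v = cbox (u $ 1, u $ 2) (v $ 1, v $ 2)" for u v
  proof (intro equalityI subsetI)
    fix q assume "q \<in> cbox (u $ 1, u $ 2) (v $ 1, v $ 2)"
    then have "k q \<in> cbox u v"
      by (cases q) (auto simp: k_def mem_box_cart forall_2)
    then show "q \<in> g ` cbox u v" using gk by (metis imageI)
  qed (auto simp: g_def mem_box_cart forall_2)
  have kbox: "k ` cbox u v = cbox (k u) (k v)" for u v
  proof -
    have "cbox u v = g ` cbox (k u) (k v)"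
      by (simp add: gbox k_def)
    then show ?thesis by (simp add: image_image kg)
  qed
  have "((\<lambda>z. h (g z)) has_integral (1 / 1) *\<^sub>R I) (k ` cbox (a, c) (b, d))"
  proof (rule has_integral_twiddle[OF _ kg gk])
    show "continuous (at z) g" for z
      unfolding g_def by (intro continuous_intros)
    show "Henstock_Kurzweil_Integration.content (g ` cbox u v) = 1 * Henstock_Kurzweil_Integration.content (cbox u v)" for u v :: "real^2"
    proof (cases "cbox u v = {}")
      case False
      then show ?thesis
        using content_cbox_cart[OF False]
        by (auto simp: gbox content_Pair UNIV_2 interval_ne_empty_cart forall_2)
    qed simp
  qed (use gbox kbox assms in auto)
  moreover have "k ` cbox (a, c) (b, d) = {z. a \<le> z $ 1 \<and> z $ 1 \<le> b \<and> c \<le> z $ 2 \<and> z $ 2 \<le> d}"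
    by (auto simp: kbox mem_box_cart forall_2) (auto simp: k_def)
  ultimately show ?thesis by (simp add: g_def)
qed

text \<open>On the half-open rectangle \<open>\<Psi>\<close> is injective, and what that rectangle omits of the closed one is
negligible, as is the centre \<open>p\<close>. The Jacobian factor is absorbed into \<open>h\<close>, which stays continuous
at the edge \<open>\<rho> = 0\<close> where the derivative of \<open>\<Psi>\<close> is not controlled.\<close>

lemma polar_change_of_variables:
  fixes \<Psi> :: "real \<times> real \<Rightarrow> real^2" and w :: "real^2 \<Rightarrow> real" and r :: real
  defines "D \<equiv> {0<..r} \<times> {0..2*pi}"
  assumes d\<Psi>: "\<And>q. q \<in> D \<Longrightarrow> (\<Psi> has_derivative \<Psi>' q) (at q within D)"
    and bij: "bij_betw \<Psi> ({0<..r} \<times> {0..<2*pi}) (U - {p})"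
    and w: "\<And>x. x \<in> U \<Longrightarrow> 0 \<le> w x"
    and h: "continuous_on (cbox (0, 0) (r, 2*pi)) h"
    and h_eq: "\<And>q. q \<in> D \<Longrightarrow> h q = \<bar>\<Psi>' q (1, 0) $ 1 * \<Psi>' q (0, 1) $ 2 - \<Psi>' q (1, 0) $ 2 * \<Psi>' q (0, 1) $ 1\<bar> * w (\<Psi> q)"
  shows "integral U w = integral (cbox (0, 0) (r, 2*pi)) h"
proof -
  define D0 where "D0 = {0<..r} \<times> {0..<2*pi}"
  have D0: "D0 \<subseteq> D" by (auto simp: D0_def D_def)
  define pr where "pr z = (z $ 1, z $ 2)" for z :: "real^2"
  define S where "S = {z. pr z \<in> D0}"
  define B where "B = {z::real^2. 0 \<le> z $ 1 \<and> z $ 1 \<le> r \<and> 0 \<le> z $ 2 \<and> z $ 2 \<le> 2*pi}"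
  define J where "J z v = \<Psi>' (pr z) (pr v)" for z v
  define I where "I = integral (cbox (0, 0) (r, 2*pi)) h"
  have "{z::real^2. 0 < z $ 1} \<inter> {z. z $ 1 \<le> r} \<inter> {z. 0 \<le> z $ 2} \<inter> {z. z $ 2 < 2*pi} \<in> sets borel"
    by (intro sets.Int borel_open borel_closed open_halfspace_component_gt_cart
        open_halfspace_component_lt_cart closed_halfspace_component_le_cart closed_halfspace_component_ge_cart)
  also have "{z::real^2. 0 < z $ 1} \<inter> {z. z $ 1 \<le> r} \<inter> {z. 0 \<le> z $ 2} \<inter> {z. z $ 2 < 2*pi} = S"
    by (auto simp: S_def D0_def pr_def)
  finally have S: "S \<in> sets lebesgue" by (simp add: sets_completionI_sets)
  have pr_S: "pr ` S = D0"
  proof (intro equalityI subsetI)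
    fix q assume "q \<in> D0"
    then have "vector [fst q, snd q] \<in> S" "q = pr (vector [fst q, snd q])"
      by (auto simp: S_def pr_def)
    then show "q \<in> pr ` S" by blast
  qed (auto simp: S_def)
  have pr_der: "(pr has_derivative pr) (at z within S)" for z
    unfolding pr_def
    by (intro has_derivative_Pair bounded_linear_imp_has_derivative bounded_linear_vec_nth)
  have der: "((\<lambda>z. \<Psi> (pr z)) has_derivative J z) (at z within S)" if "z \<in> S" for z
    unfolding J_def
    using that D0 pr_S by (intro has_derivative_in_compose[OF pr_der]) 
      (auto intro!: has_derivative_subset[OF d\<Psi>] simp: S_def)
  have inj: "inj_on (\<lambda>z. \<Psi> (pr z)) S"
  proof (rule inj_onI)
    fix y z assume yz: "y \<in> S" "z \<in> S" "\<Psi> (pr y) = \<Psi> (pr z)"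
    then have "pr y = pr z"
      using bij_betw_imp_inj_on[OF bij] by (auto simp: S_def D0_def dest: inj_onD)
    then show "y = z" by (simp add: pr_def vec_eq_iff forall_2)
  qed
  have img: "(\<lambda>z. \<Psi> (pr z)) ` S = U - {p}"
    using bij_betw_imp_surj_on[OF bij] pr_S by (metis D0_def image_image)
  have detJ: "\<bar>det (matrix (J z))\<bar> * w (\<Psi> (pr z)) = h (pr z)" if "z \<in> S" for z
    using h_eq[of "pr z"] that D0 by (auto simp: S_def det_2 matrix_def J_def pr_def axis_def mult.commute)
  have "(h has_integral I) (cbox (0, 0) (r, 2*pi))"
    unfolding I_def by (intro integrable_integral integrable_continuous h)
  then have "((\<lambda>z. h (pr z)) has_integral I) B"
    unfolding pr_def B_def by (rule has_integral_vec2)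
  then have "((\<lambda>z. h (pr z)) has_integral I) S"
  proof (rule has_integral_spike_set_eq[THEN iffD1, rotated 2])
    have "negligible ({z::real^2. z $ 1 = 0} \<union> {z. z $ 2 = 2*pi})"
      using negligible_standard_hyperplane[of "axis 1 1 :: real^2" 0]
        negligible_standard_hyperplane[of "axis 2 1 :: real^2" "2*pi"]
      by (auto simp: inner_axis axis_in_Basis_iff)
    then show "negligible {z \<in> B - S. h (pr z) \<noteq> 0}"
      by (rule negligible_subset) (auto simp: B_def S_def D0_def pr_def)
    show "negligible {z \<in> S - B. h (pr z) \<noteq> 0}"
      by (rule negligible_subset[OF negligible_empty]) (auto simp: B_def S_def D0_def pr_def)
  qed
  then have hi: "((\<lambda>z. \<bar>det (matrix (J z))\<bar> * w (\<Psi> (pr z))) has_integral I) S"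
    by (rule has_integral_eq[rotated]) (simp add: detJ)
  have "(\<lambda>z. \<bar>det (matrix (J z))\<bar> * w (\<Psi> (pr z))) absolutely_integrable_on S"
  proof (rule nonnegative_absolutely_integrable_1[rotated])
    fix z assume "z \<in> S"
    then have "\<Psi> (pr z) \<in> U" using img by blast
    then show "0 \<le> \<bar>det (matrix (J z))\<bar> * w (\<Psi> (pr z))" using w by simp
  qed (rule has_integral_integrable[OF hi])
  \<comment> \<open>The scalar integrand is read as a vector of dimension 1 for the change of
    variables.\<close>
  have lift: "bounded_linear (vec :: real \<Rightarrow> real^1)"
    by (rule bounded_linear_intro[where K = 1]) (auto simp: vec_eq_iff norm_real vec_component)
  have "(vec \<circ> (\<lambda>z. \<bar>det (matrix (J z))\<bar> * w (\<Psi> (pr z))) :: _ \<Rightarrow> real^1) absolutely_integrable_on S"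
    by (rule absolutely_integrable_linear) fact+
  moreover have "integral S (vec \<circ> (\<lambda>z. \<bar>det (matrix (J z))\<bar> * w (\<Psi> (pr z))) :: _ \<Rightarrow> real^1) = vec I"
    using hi by (subst integral_linear[OF _ lift]) (auto simp: integral_unique has_integral_integrable)
  moreover have "vec \<circ> (\<lambda>z. \<bar>det (matrix (J z))\<bar> * w (\<Psi> (pr z)))
      = (\<lambda>z. \<bar>det (matrix (J z))\<bar> *\<^sub>R (vec (w (\<Psi> (pr z))) :: real^1))"
    by (simp add: fun_eq_iff vec_eq_iff)
  ultimately have "(\<lambda>x. vec (w x) :: real^1) absolutely_integrable_on (U - {p}) \<and>
      integral (U - {p}) (\<lambda>x. vec (w x) :: real^1) = vec I"
    using has_absolute_integral_change_of_variables[OF S der inj, of "\<lambda>x. vec (w x) :: real^1" "vec I"]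
    by (simp add: img)
  then have "integral (U - {p}) (\<lambda>x. (vec (w x) :: real^1) $ 1) = I"
    by (subst integral_component_eq_cart) (auto simp: absolutely_integrable_on_def)
  moreover have "integral (U - {p}) w = integral U w"
    by (intro integral_spike_set negligible_subset[OF negligible_sing[of p]]) auto
  ultimately show ?thesis by (simp add: I_def)
qed

section \<open>The unit normal and the Gaussian curvature\<close>

lemma has_vector_derivative_along:
  assumes F: "(F has_derivative F') (at (\<gamma> t) within S)"
    and \<gamma>: "(\<gamma> has_vector_derivative \<gamma>') (at t within I)" and sub: "\<gamma> ` I \<subseteq> S"
  shows "((\<lambda>t. F (\<gamma> t)) has_vector_derivative F' \<gamma>') (at t within I)"
proof -
  interpret F': bounded_linear F' by (rule has_derivative_bounded_linear[OF F])
  have "((\<lambda>t. F (\<gamma> t)) has_derivative (\<lambda>s. F' (s *\<^sub>R \<gamma>'))) (at t within I)"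
    using \<gamma> unfolding has_vector_derivative_def
    by (rule has_derivative_in_compose) (rule has_derivative_subset[OF F sub])
  then show ?thesis
    by (simp add: has_vector_derivative_def F'.scaleR)
qed

text \<open>For the closed disc this is applied at interior points; the resulting identities between derivatives
extend to the boundary circle by continuity, so that uniqueness of the derivative is not at issue there.\<close>

lemma has_derivative_locally_constant:
  assumes F: "(F has_derivative F') (at x within S)" and x: "x \<in> interior S"
    and const: "\<And>y. y \<in> S \<Longrightarrow> F y = c"
  shows "F' v = 0"
proof -
  have "x \<in> S" using x interior_subset by blast
  then have "(F has_derivative (\<lambda>_. 0)) (at x within S)"
    by (rule has_derivative_transform[OF _ _ has_derivative_const[of c]]) (rule const)
  then have "F' = (\<lambda>_. 0)"
    using F unfolding at_within_interior[OF x] by (intro has_derivative_unique)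
  then show ?thesis by simp
qed

lemma bounded_bilinear_cross3: "bounded_bilinear cross3"
  using bilinear_cross by (simp add: bilinear_conv_bounded_bilinear)

lemma cross3_inner_cross3:
  "cross3 a b \<bullet> cross3 c d = (a \<bullet> c) * (b \<bullet> d) - (a \<bullet> d) * (b \<bullet> c)"
  by (simp add: cross3_simps)

lemma vec2_eq_axis: "(w :: real^2) = w $ 1 *\<^sub>R axis 1 1 + w $ 2 *\<^sub>R axis 2 1"
  by (simp add: vec_eq_iff forall_2 axis_def)

lemma linear_vec2:
  assumes "linear (L :: real^2 \<Rightarrow> 'b::real_vector)"
  shows "L w = w $ 1 *\<^sub>R L (axis 1 1) + w $ 2 *\<^sub>R L (axis 2 1)"
  by (subst vec2_eq_axis) (simp add: linear_add[OF assms] linear_scale[OF assms])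

lemma linear_dir_deriv:
  assumes "F differentiable (at p within S)"
  shows "linear (\<lambda>w. dir_deriv S w F p)"
  using assms by (simp add: dir_deriv_def frechet_derivative_works has_derivative_linear)

text \<open>Rank 2 makes the differential injective, so the two partial derivatives cannot be proportional.\<close>

lemma cross_partials_nonzero:
  assumes "immersion X" "X differentiable_on unit_disc" "p \<in> unit_disc"
  shows "cross3 (D_u X p) (D_v X p) \<noteq> 0"
proof
  let ?A = "jacobian X (at p within unit_disc)"
  have lin: "linear (\<lambda>w. dir_deriv unit_disc w X p)"
    using assms by (intro linear_dir_deriv) (auto simp: differentiable_on_def)
  have A: "?A *v w = dir_deriv unit_disc w X p" for w
    unfolding jacobian_def dir_deriv_def using lin by (simp add: dir_deriv_def linear_matrix_vector_mul_eq matrix_works)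
  have inj: "inj ((*v) ?A)"
    using assms full_rank_injective[of ?A] by (simp add: immersion_def)
  have indep: "a = 0 \<and> b = 0" if "a *\<^sub>R D_u X p + b *\<^sub>R D_v X p = 0" for a b
  proof -
    have "?A *v (a *\<^sub>R axis 1 1 + b *\<^sub>R axis 2 1) = ?A *v 0"
      using that by (simp add: A linear_add[OF lin] linear_scale[OF lin] D_u_def D_v_def linear_0[OF lin])
    then have "a *\<^sub>R axis 1 1 + b *\<^sub>R axis 2 1 = (0 :: real^2)"
      using inj by (meson injD)
    then show ?thesis
      by (simp add: vec_eq_iff forall_2 axis_def)
  qed
  assume "cross3 (D_u X p) (D_v X p) = 0"
  then consider "D_u X p = 0" | "D_v X p = 0" | c where "D_v X p = c *\<^sub>R D_u X p"
    by (auto simp: cross_eq_0 collinear_lemma)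
  then show False
    using indep[of 1 0] indep[of 0 1] indep[of _ "-1"] by cases auto
qed

lemma partials_commute:
  fixes X :: "real^2 \<Rightarrow> 'b::banach"
  assumes C2: "C_k_on 2 unit_disc X" and p: "p \<in> ball 0 1"
  shows "D_u (D_v X) p = D_v (D_u X) p"
proof -
  define q where "q x y = x *\<^sub>R axis 1 1 + y *\<^sub>R (axis 2 1 :: real^2)" for x y
  have C2': "C_k_on (Suc (Suc 0)) unit_disc X" using C2 by (simp add: numeral_2_eq_2)
  then have Xdir: "C_k_on (Suc 0) unit_disc (dir_deriv unit_disc v X)" for v by simp
  note dX = has_C1_derivativeD[OF C_k_on_imp_has_C1_derivative[OF C2']]
  note ddX = has_C1_derivativeD[OF C_k_on_imp_has_C1_derivative[OF Xdir]]
  obtain e where "e > 0" and e: "cball p e \<subseteq> unit_disc"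
    using p open_contains_cball[of "ball 0 1"] by (force simp: unit_disc_def)
  define I where "I i = {p $ i - e/2..p $ i + e/2}" for i
  have q_disc: "q x y \<in> unit_disc" if "x \<in> I 1" "y \<in> I 2" for x y
  proof -
    have "norm (p - q x y) \<le> \<bar>p $ 1 - x\<bar> + \<bar>p $ 2 - y\<bar>"
      using norm_le_l1_cart[of "p - q x y"] by (simp add: q_def sum_2 axis_def)
    also have "\<dots> \<le> e" using that by (auto simp: I_def abs_if)
    finally show ?thesis using e by (auto simp: dist_norm)
  qed
  have q1: "((\<lambda>x. q x y) has_vector_derivative axis 1 1) (at x within J)" for x y J
    unfolding q_def by (auto intro!: derivative_eq_intros)
  have q2: "((\<lambda>y. q x y) has_vector_derivative axis 2 1) (at y within J)" for x y J
    unfolding q_def by (auto intro!: derivative_eq_intros)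
  have contq: "continuous_on J (\<lambda>z. q (f z) (g z))"
    if "continuous_on J f" "continuous_on J g" for f g and J :: "'c::topological_space set"
    unfolding q_def by (intro continuous_intros that)
  have pI: "p $ 1 \<in> I 1" "p $ 2 \<in> I 2" and qp: "q (p $ 1) (p $ 2) = p"
    using \<open>e > 0\<close> vec2_eq_axis[of p] by (auto simp: I_def q_def)
  have "((\<lambda>x. D_v X (q x (p $ 2))) has_vector_derivative D_v (D_u X) (q (p $ 1) (p $ 2)))
      (at (p $ 1) within {p $ 1 - e/2..p $ 1 + e/2})"
  proof (rule mixed_partial_swap[where F = "\<lambda>x y. X (q x y)" and G = "\<lambda>x y. D_u X (q x y)"
        and c = "p $ 2 - e/2" and d = "p $ 2 + e/2"]; (fold I_def)?)
    fix x y assume "x \<in> I 1" "y \<in> I 2"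
    then show "((\<lambda>x. X (q x y)) has_vector_derivative D_u X (q x y)) (at x within I 1)"
      unfolding D_u_def
      by (intro has_vector_derivative_along[OF dX(1) q1]) (auto intro: q_disc)
  next
    fix x y assume "x \<in> I 1" "y \<in> I 2"
    then show "((\<lambda>y. X (q x y)) has_vector_derivative D_v X (q x y)) (at y within I 2)"
      unfolding D_v_def
      by (intro has_vector_derivative_along[OF dX(1) q2]) (auto intro: q_disc)
  next
    fix x y assume "x \<in> I 1" "y \<in> I 2"
    then show "((\<lambda>y. D_u X (q x y)) has_vector_derivative D_v (D_u X) (q x y)) (at y within I 2)"
      unfolding D_u_def D_v_def
      by (intro has_vector_derivative_along[OF ddX(1) q2]) (auto intro: q_disc)
  next
    have "continuous_on (I 1 \<times> I 2) (\<lambda>z. D_v (D_u X) (q (fst z) (snd z)))"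
      unfolding D_u_def D_v_def
      by (rule continuous_on_compose2[OF ddX(2)])
         (auto intro!: q_disc contq continuous_intros)
    then show "continuous_on (I 1 \<times> I 2) (\<lambda>(x, y). D_v (D_u X) (q x y))"
      by (simp add: split_beta)
  next
    fix y assume "y \<in> I 2"
    then show "continuous_on (I 1) (\<lambda>x. D_u X (q x y))"
      unfolding D_u_def
      by (intro continuous_on_compose2[OF ddX(3)])
         (auto intro!: q_disc contq continuous_intros)
  qed (use pI \<open>e > 0\<close> in auto)
  moreover have "((\<lambda>x. D_v X (q x (p $ 2))) has_vector_derivative D_u (D_v X) (q (p $ 1) (p $ 2)))
      (at (p $ 1) within I 1)"
    unfolding D_u_def D_v_def using pI
    by (intro has_vector_derivative_along[OF ddX(1) q1]) (auto intro: q_disc)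
  ultimately show ?thesis
    using vector_derivative_unique_within_closed_interval[of "p $ 1 - e/2" "p $ 1 + e/2" "p $ 1"] \<open>e > 0\<close>
    by (auto simp: I_def qp)
qed

text \<open>The Gauss map multiplies oriented area by the Gaussian curvature. The Weingarten equations
\<open>n\<^sub>i \<bullet> X\<^sub>j = - n \<bullet> X\<^sub>i\<^sub>j\<close>, which come from differentiating \<open>n \<bullet> X\<^sub>j = 0\<close>, turn
\<open>(X\<^sub>u \<times> X\<^sub>v) \<bullet> (n\<^sub>u \<times> n\<^sub>v)\<close> into the determinant of the second fundamental form, by Lagrange's
identity. This is done in the open disc and extended to the boundary by continuity.\<close>

lemma unit_normal_derivative:
  assumes C3: "C_k_on 3 unit_disc X" and imm: "immersion X"
  obtains N' where "has_C1_derivative (unit_normal X) N' unit_disc"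
    and "\<And>p. p \<in> unit_disc \<Longrightarrow>
          unit_normal X p \<bullet> cross3 (N' p (axis 1 1)) (N' p (axis 2 1))
            = gauss_curvature X p * norm (cross3 (D_u X p) (D_v X p))"
    and "continuous_on unit_disc (gauss_curvature X)"
proof -
  have C3': "C_k_on (Suc (Suc (Suc 0))) unit_disc X" using C3 by (simp add: numeral_3_eq_3)
  have C2: "C_k_on 2 unit_disc X" using C_k_on_SucD[OF C3'] by (simp add: numeral_2_eq_2)
  have diff: "X differentiable_on unit_disc" using C3' by simp
  have Xdir: "C_k_on (Suc (Suc 0)) unit_disc (dir_deriv unit_disc v X)" for v using C3' by simp
  note dX = C_k_on_imp_has_C1_derivative[OF C3']
  note ddX = C_k_on_imp_has_C1_derivative[OF Xdir]
  let ?e1 = "axis 1 1 :: real^2" and ?e2 = "axis 2 1 :: real^2"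
  define c where "c p = cross3 (D_u X p) (D_v X p)" for p
  have c0: "c p \<noteq> 0" if "p \<in> unit_disc" for p
    using cross_partials_nonzero[OF imm diff that] by (simp add: c_def)
  define c' where "c' p v = cross3 (D_u X p) (dir_deriv unit_disc v (D_v X) p)
      + cross3 (dir_deriv unit_disc v (D_u X) p) (D_v X p)" for p v
  have C1c: "has_C1_derivative c c' unit_disc"
    unfolding c_def[abs_def] c'_def[abs_def] D_u_def D_v_def
    by (rule has_C1_derivative_bilinear[OF bounded_bilinear_cross3 ddX ddX])
  obtain g' where g': "has_C1_derivative (sgn :: real^3 \<Rightarrow> real^3) g' (- {0})"
    using has_C1_derivative_sgn .
  define N where "N = unit_normal X"
  define N' where "N' p v = g' (c p) (c' p v)" for p v
  have N: "N p = sgn (c p)" for p by (simp add: N_def unit_normal_def c_def)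
  have C1N: "has_C1_derivative N N' unit_disc"
    unfolding N[abs_def] N'_def[abs_def]
    by (rule has_C1_derivative_compose[OF g' C1c]) (use c0 in auto)
  have cont2: "continuous_on unit_disc (D_u (D_u X))" "continuous_on unit_disc (D_v (D_u X))"
       "continuous_on unit_disc (D_v (D_v X))"
    using has_C1_derivativeD(2)[OF ddX] by (simp_all add: D_u_def D_v_def)
  note contN = has_C1_derivativeD(3)[OF C1N]
  have nc: "(D_u X p \<bullet> D_u X p) * (D_v X p \<bullet> D_v X p) - (D_u X p \<bullet> D_v X p)\<^sup>2 = (norm (c p))\<^sup>2" for p
    by (simp add: c_def power2_norm_eq_inner cross3_inner_cross3 power2_eq_square[of "_ \<bullet> _"] inner_commute)
  have K: "gauss_curvature X p = ((D_u (D_u X) p \<bullet> N p) * (D_v (D_v X) p \<bullet> N p)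
        - (D_v (D_u X) p \<bullet> N p)\<^sup>2) / (norm (c p))\<^sup>2" for p
    by (simp add: gauss_curvature_def nc N_def)
  have contK: "continuous_on unit_disc (gauss_curvature X)"
    unfolding K[abs_def]
    by (intro continuous_intros cont2 contN has_C1_derivativeD(3)[OF C1c]) (use c0 in auto)
  have ball: "N p \<bullet> cross3 (N' p ?e1) (N' p ?e2) = gauss_curvature X p * norm (c p)"
    if p: "p \<in> ball 0 1" for p
  proof -
    have pD: "p \<in> unit_disc" and pI: "p \<in> interior unit_disc"
      using p by (auto simp: unit_disc_def)
    have ortho: "dir_deriv unit_disc w X p \<bullet> N' p v = - (dir_deriv unit_disc v (dir_deriv unit_disc w X) p \<bullet> N p)"
      if w: "w = ?e1 \<or> w = ?e2" for v w
    proof -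
      have "N q \<bullet> dir_deriv unit_disc w X q = 0" for q
        using w by (auto simp: N sgn_div_norm c_def D_u_def D_v_def dot_cross_self)
      moreover have "((\<lambda>q. N q \<bullet> dir_deriv unit_disc w X q) has_derivative
           (\<lambda>v. N p \<bullet> dir_deriv unit_disc v (dir_deriv unit_disc w X) p + N' p v \<bullet> dir_deriv unit_disc w X p))
           (at p within unit_disc)"
        by (intro has_derivative_inner has_C1_derivativeD(1)[OF C1N] has_C1_derivativeD(1)[OF ddX] pD)
      ultimately have "N p \<bullet> dir_deriv unit_disc v (dir_deriv unit_disc w X) p + N' p v \<bullet> dir_deriv unit_disc w X p = 0"
        by (intro has_derivative_locally_constant[OF _ pI])
      then show ?thesis by (simp add: inner_commute)
    qed
    have "c p \<bullet> cross3 (N' p ?e1) (N' p ?e2)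
        = (D_u X p \<bullet> N' p ?e1) * (D_v X p \<bullet> N' p ?e2) - (D_u X p \<bullet> N' p ?e2) * (D_v X p \<bullet> N' p ?e1)"
      by (simp add: c_def cross3_inner_cross3)
    also have "\<dots> = (D_u (D_u X) p \<bullet> N p) * (D_v (D_v X) p \<bullet> N p) - (D_v (D_u X) p \<bullet> N p)\<^sup>2"
      using ortho[of ?e1] ortho[of ?e2] partials_commute[OF C2 p]
      by (simp add: D_u_def D_v_def power2_eq_square)
    also have "\<dots> = gauss_curvature X p * (norm (c p))\<^sup>2"
      using c0[OF pD] by (simp add: K)
    finally show ?thesis
      using c0[OF pD] by (simp add: N sgn_div_norm power2_eq_square field_simps)
  qed
  have "N p \<bullet> cross3 (N' p ?e1) (N' p ?e2) = gauss_curvature X p * norm (c p)"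
    if "p \<in> unit_disc" for p
  proof -
    have "continuous_on (closure (ball 0 1))
        (\<lambda>p. N p \<bullet> cross3 (N' p ?e1) (N' p ?e2) - gauss_curvature X p * norm (c p))"
      using contN contK has_C1_derivativeD(2)[OF C1N] has_C1_derivativeD(3)[OF C1c]
      by (auto intro!: continuous_intros continuous_on_cross simp: unit_disc_def)
    from continuous_constant_on_closure[OF this, of 0 p] ball that
    show ?thesis by (simp add: unit_disc_def)
  qed
  then show thesis
    using that[of N'] C1N contK by (simp add: N_def c_def)
qed

section \<open>The Jacobi equation in a moving frame\<close>

text \<open>Every point of the rectangle can be moved inside it in both coordinate directions, with a suitable
sign; this suffices for uniqueness also at the edges.\<close>

lemma rect_derivative_unique:
  fixes q :: "real \<times> real"
  assumes "(F has_derivative A) (at q within {0<..r} \<times> {0..2*pi})"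
    and "(F has_derivative B) (at q within {0<..r} \<times> {0..2*pi})"
    and q: "q \<in> {0<..r} \<times> {0..2*pi}"
  shows "A = B"
proof (rule frechet_derivative_unique_within[OF assms(1,2)])
  obtain x y where xy: "q = (x, y)" "0 < x" "x \<le> r" "0 \<le> y" "y \<le> 2*pi"
    using q by auto
  fix i :: "real \<times> real" and e :: real assume i: "i \<in> Basis" and "e > 0"
  define d where "d = (if i = (0, 1) \<and> y < 2*pi then min (e/2) (2*pi - y)
      else if i = (0, 1) then - min (e/2) (2*pi) else - min (e/2) (x/2))"
  have "i = (1, 0) \<or> i = (0, 1)" using i by (auto simp: Basis_prod_def)
  then have "0 < \<bar>d\<bar> \<and> \<bar>d\<bar> < e \<and> q + d *\<^sub>R i \<in> {0<..r} \<times> {0..2*pi}"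
    using xy \<open>e > 0\<close> pi_gt_zero by (auto simp: d_def min_def abs_if)
  then show "\<exists>d. 0 < \<bar>d\<bar> \<and> \<bar>d\<bar> < e \<and> q + d *\<^sub>R i \<in> {0<..r} \<times> {0..2*pi}" by (rule exI)
qed

lemma has_vector_derivative_rho:
  assumes "(F has_derivative F') (at (\<rho>, \<phi>) within S)" "I \<times> {\<phi>} \<subseteq> S"
  shows "((\<lambda>t. F (t, \<phi>)) has_vector_derivative F' (1, 0)) (at \<rho> within I)"
  by (rule has_vector_derivative_along[where \<gamma> = "\<lambda>t. (t, \<phi>)" and S = S])
     (use assms in \<open>auto intro!: derivative_eq_intros has_vector_derivative_Pair\<close>)

lemma has_vector_derivative_phi:
  assumes "(F has_derivative F') (at (\<rho>, \<phi>) within S)" "{\<rho>} \<times> J \<subseteq> S"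
  shows "((\<lambda>t. F (\<rho>, t)) has_vector_derivative F' (0, 1)) (at \<phi> within J)"
  by (rule has_vector_derivative_along[where \<gamma> = "\<lambda>t. (\<rho>, t)" and S = S])
     (use assms in \<open>auto intro!: derivative_eq_intros has_vector_derivative_Pair\<close>)

lemma inner_const_derivative:
  fixes A B :: "real \<Rightarrow> 'a::real_inner"
  assumes "(A has_vector_derivative A') (at x within {a..b})"
    "(B has_vector_derivative B') (at x within {a..b})"
    and const: "\<And>y. y \<in> {a..b} \<Longrightarrow> A y \<bullet> B y = c" and x: "a < b" "x \<in> {a..b}"
  shows "A x \<bullet> B' + A' \<bullet> B x = 0"
proof -
  have "((\<lambda>y. A y \<bullet> B y) has_vector_derivative A x \<bullet> B' + A' \<bullet> B x) (at x within {a..b})"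
    by (intro bounded_bilinear.has_vector_derivative[OF bounded_bilinear_inner] assms(1,2))
  moreover have "((\<lambda>y. A y \<bullet> B y) has_vector_derivative 0) (at x within {a..b})"
    by (rule has_vector_derivative_transform[OF x(2) _ has_vector_derivative_const[of c]]) (rule const)
  ultimately show ?thesis
    using vector_derivative_unique_within_closed_interval[OF x(1), of x] x(2) by auto
qed

lemma orthogonal_to_tangent_plane:
  assumes "norm n = 1" "a \<bullet> n = 0" "b \<bullet> n = 0"
  shows "cross3 a b = (n \<bullet> cross3 a b) *\<^sub>R n"
proof -
  have "cross3 n (cross3 n v) = (n \<bullet> v) *\<^sub>R n - (n \<bullet> n) *\<^sub>R v" for v
    by (simp add: cross3_simps forall_3)
  moreover have "cross3 n (cross3 a b) = (n \<bullet> b) *\<^sub>R a - (n \<bullet> a) *\<^sub>R b"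
    by (simp add: cross3_simps forall_3)
  ultimately show ?thesis
    using assms by (metis (no_types, lifting) cross_zero_right diff_self eq_iff_diff_eq_0 inner_commute
        norm_eq_1 scaleR_one scaleR_zero_left)
qed

text \<open>Gauss's equation in a moving frame. Put \<open>E = n \<times> T\<close>, so that \<open>T, E, n\<close> is orthonormal and \<open>Y\<^sub>\<phi> = f E\<close>.
Because \<open>T\<^sub>\<rho> = W\<close> is normal, \<open>E\<^sub>\<rho> = n\<^sub>\<rho> \<times> T\<close> is normal too, and \<open>f\<^sub>\<rho> = T\<^sub>\<phi> \<bullet> E\<close>. In the next
derivative \<open>W\<^sub>\<phi> \<bullet> E + T\<^sub>\<phi> \<bullet> (n\<^sub>\<rho> \<times> T)\<close> the orthogonality relations replace the derivatives of \<open>T\<close> and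
\<open>W\<close> by derivatives of \<open>n\<close>, and what remains is the \<open>2 \<times> 2\<close> determinant of \<open>n\<^sub>\<rho>, n\<^sub>\<phi>\<close> in the
basis \<open>T, E\<close>. That \<open>Y\<^sub>\<phi>\<close> and \<open>T\<^sub>\<phi>\<close> have radial derivatives is part of the argument: the second is
where \<open>W\<close> has to be of class \<open>C\<^sup>1\<close>.\<close>

lemma jacobi_equation_frame:
  fixes Y T n W :: "real \<times> real \<Rightarrow> real^3" and r :: real
  defines "D \<equiv> {0<..r} \<times> {0..2*pi}"
  assumes Y: "\<And>q. q \<in> D \<Longrightarrow> (Y has_derivative Y' q) (at q within D)"
    and T: "has_C1_derivative T T' D"
    and n: "has_C1_derivative n n' D"
    and W: "has_C1_derivative W W' D"
    and YT: "\<And>q. q \<in> D \<Longrightarrow> Y' q (1, 0) = T q"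
    and TW: "\<And>q. q \<in> D \<Longrightarrow> T' q (1, 0) = W q"
    and Wn: "\<And>q. q \<in> D \<Longrightarrow> W q = (n q \<bullet> W q) *\<^sub>R n q"
    and nn: "\<And>q. q \<in> D \<Longrightarrow> n q \<bullet> n q = 1"
    and TT: "\<And>q. q \<in> D \<Longrightarrow> T q \<bullet> T q = 1"
    and Tn: "\<And>q. q \<in> D \<Longrightarrow> T q \<bullet> n q = 0"
    and Yn: "\<And>q. q \<in> D \<Longrightarrow> Y' q (0, 1) \<bullet> n q = 0"
    and \<rho>: "0 < \<rho>" "\<rho> < r" and \<phi>: "\<phi> \<in> {0..2*pi}"
  shows "((\<lambda>t. n (t, \<phi>) \<bullet> cross3 (T (t, \<phi>)) (Y' (t, \<phi>) (0, 1))) has_real_derivative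
            T' (\<rho>, \<phi>) (0, 1) \<bullet> cross3 (n (\<rho>, \<phi>)) (T (\<rho>, \<phi>))) (at \<rho>)" (is ?f)
    and "((\<lambda>t. T' (t, \<phi>) (0, 1) \<bullet> cross3 (n (t, \<phi>)) (T (t, \<phi>))) has_real_derivative
            - (n (\<rho>, \<phi>) \<bullet> cross3 (n' (\<rho>, \<phi>) (1, 0)) (n' (\<rho>, \<phi>) (0, 1)))) (at \<rho>)" (is ?g)
proof -
  let ?q = "(\<rho>, \<phi>)" and ?I = "{\<rho>/2..r}" and ?J = "{0..2*pi}"
  have q: "?q \<in> D" using \<rho> \<phi> by (auto simp: D_def)
  have sub: "y \<in> ?J \<Longrightarrow> ?I \<times> {y} \<subseteq> D" "x \<in> ?I \<Longrightarrow> {x} \<times> ?J \<subseteq> D" "x \<in> ?I \<Longrightarrow> y \<in> ?J \<Longrightarrow> (x, y) \<in> D" for x y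
    using \<rho> by (auto simp: D_def)
  have \<rho>I: "\<rho> \<in> ?I" using \<rho> by auto
  have at: "at \<rho> within ?I = at \<rho>"
    using \<rho> by (intro at_within_interior) (auto simp: interior_atLeastAtMost_real)
  note dT = has_C1_derivativeD[OF T] and dn = has_C1_derivativeD[OF n] and dW = has_C1_derivativeD[OF W]
  have contD: "continuous_on (?I \<times> ?J) (\<lambda>(x, y). F (x, y))" "y \<in> ?J \<Longrightarrow> continuous_on ?I (\<lambda>x. F (x, y))"
    if "continuous_on D F" for F :: "real \<times> real \<Rightarrow> real^3" and y
  proof -
    show "continuous_on (?I \<times> ?J) (\<lambda>(x, y). F (x, y))"
      unfolding case_prod_eta using \<rho> by (intro continuous_on_subset[OF that]) (auto simp: D_def)
    show "continuous_on ?I (\<lambda>x. F (x, y))" if "y \<in> ?J"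
      using \<rho> that
      by (intro continuous_on_compose2[OF \<open>continuous_on D F\<close>])
         (auto simp: D_def intro!: continuous_on_Pair continuous_on_const continuous_on_id)
  qed
  have Y\<phi>: "((\<lambda>t. Y' (t, \<phi>) (0, 1)) has_vector_derivative T' ?q (0, 1)) (at \<rho> within ?I)"
  proof (rule mixed_partial_swap[where F = "\<lambda>x y. Y (x, y)" and G = "\<lambda>x y. T (x, y)"
        and L = "\<lambda>x y. Y' (x, y) (0, 1)" and H = "\<lambda>x y. T' (x, y) (0, 1)" and c = 0 and d = "2*pi"])
    fix x y assume xy: "x \<in> ?I" "y \<in> ?J"
    show "((\<lambda>x. Y (x, y)) has_vector_derivative T (x, y)) (at x within ?I)"
      unfolding YT[OF sub(3)[OF xy], symmetric]
      by (intro has_vector_derivative_rho[OF Y[OF sub(3)[OF xy]]] sub xy)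
    show "((\<lambda>y. Y (x, y)) has_vector_derivative Y' (x, y) (0, 1)) (at y within ?J)"
      by (intro has_vector_derivative_phi[OF Y[OF sub(3)[OF xy]]] sub xy)
    show "((\<lambda>y. T (x, y)) has_vector_derivative T' (x, y) (0, 1)) (at y within ?J)"
      by (intro has_vector_derivative_phi[OF dT(1)[OF sub(3)[OF xy]]] sub xy)
  qed (use contD[OF dT(2)] contD[OF dT(3)] \<rho>I \<phi> pi_gt_zero in auto)
  have T\<phi>: "((\<lambda>t. T' (t, \<phi>) (0, 1)) has_vector_derivative W' ?q (0, 1)) (at \<rho> within ?I)"
  proof (rule mixed_partial_swap[where F = "\<lambda>x y. T (x, y)" and G = "\<lambda>x y. W (x, y)"
        and L = "\<lambda>x y. T' (x, y) (0, 1)" and H = "\<lambda>x y. W' (x, y) (0, 1)" and c = 0 and d = "2*pi"])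
    fix x y assume xy: "x \<in> ?I" "y \<in> ?J"
    show "((\<lambda>x. T (x, y)) has_vector_derivative W (x, y)) (at x within ?I)"
      unfolding TW[OF sub(3)[OF xy], symmetric]
      by (intro has_vector_derivative_rho[OF dT(1)[OF sub(3)[OF xy]]] sub xy)
    show "((\<lambda>y. T (x, y)) has_vector_derivative T' (x, y) (0, 1)) (at y within ?J)"
      by (intro has_vector_derivative_phi[OF dT(1)[OF sub(3)[OF xy]]] sub xy)
    show "((\<lambda>y. W (x, y)) has_vector_derivative W' (x, y) (0, 1)) (at y within ?J)"
      by (intro has_vector_derivative_phi[OF dW(1)[OF sub(3)[OF xy]]] sub xy)
  qed (use contD[OF dW(2)] contD[OF dW(3)] \<rho>I \<phi> pi_gt_zero in auto)
  have T\<rho>: "((\<lambda>t. T (t, \<phi>)) has_vector_derivative W ?q) (at \<rho> within ?I)"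
    unfolding TW[OF q, symmetric] by (intro has_vector_derivative_rho[OF dT(1)[OF q]] sub \<rho>I \<phi>)
  have n\<rho>: "((\<lambda>t. n (t, \<phi>)) has_vector_derivative n' ?q (1, 0)) (at \<rho> within ?I)"
    by (intro has_vector_derivative_rho[OF dn(1)[OF q]] sub \<rho>I \<phi>)
  have T\<psi>: "((\<lambda>t. T (\<rho>, t)) has_vector_derivative T' ?q (0, 1)) (at \<phi> within ?J)"
    by (intro has_vector_derivative_phi[OF dT(1)[OF q]] sub \<rho>I \<phi>)
  have n\<psi>: "((\<lambda>t. n (\<rho>, t)) has_vector_derivative n' ?q (0, 1)) (at \<phi> within ?J)"
    by (intro has_vector_derivative_phi[OF dn(1)[OF q]] sub \<rho>I \<phi>)
  have W\<psi>: "((\<lambda>t. W (\<rho>, t)) has_vector_derivative W' ?q (0, 1)) (at \<phi> within ?J)"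
    by (intro has_vector_derivative_phi[OF dW(1)[OF q]] sub \<rho>I \<phi>)
  define N T0 W0 where "N = n ?q" and "T0 = T ?q" and "W0 = W ?q"
  define Nr Np Tp Wp Yp where "Nr = n' ?q (1, 0)" and "Np = n' ?q (0, 1)"
    and "Tp = T' ?q (0, 1)" and "Wp = W' ?q (0, 1)" and "Yp = Y' ?q (0, 1)"
  have norm: "norm N = 1" and TN: "T0 \<bullet> N = 0" and YN: "Yp \<bullet> N = 0" and WN: "W0 = (N \<bullet> W0) *\<^sub>R N"
    using nn[OF q] Tn[OF q] Yn[OF q] Wn[OF q] by (auto simp: N_def T0_def Yp_def W0_def norm_eq_1)
  have NrN: "Nr \<bullet> N = 0"
    using inner_const_derivative[OF n\<rho> n\<rho>, of 1] nn sub(3)[OF _ \<phi>] \<rho> 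
    by (simp add: N_def Nr_def inner_commute)
  have NrT: "N \<bullet> W0 = - (T0 \<bullet> Nr)"
    using inner_const_derivative[OF T\<rho> n\<rho>, of 0] Tn sub(3)[OF _ \<phi>] \<rho>
    by (simp add: N_def Nr_def T0_def W0_def inner_commute)
  have NpT: "Tp \<bullet> N = - (T0 \<bullet> Np)"
    using inner_const_derivative[OF T\<psi> n\<psi>, of 0] Tn sub(3)[OF \<rho>I] \<phi>
    by (simp add: N_def Np_def T0_def Tp_def)
  have WpE: "Wp \<bullet> cross3 N T0 = (T0 \<bullet> Nr) * (N \<bullet> cross3 Np T0)"
  proof -
    have "W (\<rho>, y) \<bullet> cross3 (n (\<rho>, y)) (T (\<rho>, y)) = 0" if "y \<in> ?J" for y
      using Wn[OF sub(3)[OF \<rho>I that]] dot_cross_self(1) inner_scaleR_left by (metis mult_zero_right)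
    from inner_const_derivative[OF W\<psi> bounded_bilinear.has_vector_derivative[OF bounded_bilinear_cross3 n\<psi> T\<psi>] this _ \<phi>]
    have "W0 \<bullet> (cross3 N Tp + cross3 Np T0) + Wp \<bullet> cross3 N T0 = 0"
      by (simp add: N_def Np_def T0_def Tp_def W0_def Wp_def)
    moreover have "W0 \<bullet> (cross3 N Tp + cross3 Np T0) = - (T0 \<bullet> Nr) * (N \<bullet> cross3 Np T0)"
      by (subst WN) (simp add: inner_add_right dot_cross_self NrT)
    ultimately show ?thesis by simp
  qed
  have "((\<lambda>t. n (t, \<phi>) \<bullet> cross3 (T (t, \<phi>)) (Y' (t, \<phi>) (0, 1))) has_vector_derivative
      N \<bullet> (cross3 T0 Tp + cross3 W0 Yp) + Nr \<bullet> cross3 T0 Yp) (at \<rho> within ?I)"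
    unfolding N_def T0_def W0_def Nr_def Tp_def Yp_def
    by (intro bounded_bilinear.has_vector_derivative[OF bounded_bilinear_inner]
        bounded_bilinear.has_vector_derivative[OF bounded_bilinear_cross3] n\<rho> T\<rho> Y\<phi>)
  moreover have "N \<bullet> (cross3 T0 Tp + cross3 W0 Yp) + Nr \<bullet> cross3 T0 Yp = Tp \<bullet> cross3 N T0"
  proof -
    have "Nr \<bullet> cross3 T0 Yp = 0"
      by (subst orthogonal_to_tangent_plane[OF norm TN YN]) (simp add: NrN)
    moreover have "N \<bullet> cross3 W0 Yp = 0"
      by (subst WN) (simp add: cross_mult_left dot_cross_self)
    moreover have "N \<bullet> cross3 T0 Tp = Tp \<bullet> cross3 N T0" by (simp add: cross3_simps)
    ultimately show ?thesis by (simp add: inner_add_right)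
  qed
  ultimately show ?f
    by (simp add: at has_real_derivative_iff_has_vector_derivative Tp_def N_def T0_def)
  have "((\<lambda>t. T' (t, \<phi>) (0, 1) \<bullet> cross3 (n (t, \<phi>)) (T (t, \<phi>))) has_vector_derivative
      Tp \<bullet> (cross3 N W0 + cross3 Nr T0) + Wp \<bullet> cross3 N T0) (at \<rho> within ?I)"
    unfolding N_def T0_def W0_def Nr_def Tp_def Wp_def
    by (intro bounded_bilinear.has_vector_derivative[OF bounded_bilinear_inner]
        bounded_bilinear.has_vector_derivative[OF bounded_bilinear_cross3] n\<rho> T\<rho> T\<phi>)
  moreover have "Tp \<bullet> (cross3 N W0 + cross3 Nr T0) + Wp \<bullet> cross3 N T0 = - (N \<bullet> cross3 Nr Np)"
  proof -
    have "cross3 N W0 = 0" by (subst WN) (simp add: cross_mult_right)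
    moreover have "Tp \<bullet> cross3 Nr T0 = - (T0 \<bullet> Np) * (N \<bullet> cross3 Nr T0)"
      by (subst orthogonal_to_tangent_plane[OF norm NrN TN]) (simp add: NpT)
    moreover have "(T0 \<bullet> Nr) * (N \<bullet> cross3 Np T0) - (T0 \<bullet> Np) * (N \<bullet> cross3 Nr T0) = - (N \<bullet> cross3 Nr Np)"
    proof -
      have "(a \<bullet> u) *\<^sub>R cross3 v a - (a \<bullet> v) *\<^sub>R cross3 u a = (a \<bullet> cross3 u v) *\<^sub>R a - (a \<bullet> a) *\<^sub>R cross3 u v"
        for a u v :: "real^3"
        by (simp add: cross3_simps forall_3)
      from arg_cong[OF this[of T0 Nr Np], of "\<lambda>x. N \<bullet> x"] TN TT[OF q] show ?thesis
        by (simp add: inner_diff_right inner_commute[of N T0] T0_def[symmetric])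
    qed
    ultimately show ?thesis by (simp add: inner_add_right WpE)
  qed
  ultimately show ?g
    by (simp add: at has_real_derivative_iff_has_vector_derivative Nr_def N_def Np_def)
qed

section \<open>The area density in geodesic polar coordinates\<close>

text \<open>The signed density \<open>f\<close> and its radial derivative \<open>g\<close>. The modulus of \<open>f\<close> is \<open>sqrt P\<close>, and \<open>f\<close> is also the
Jacobian determinant of \<open>\<Psi>\<close> times \<open>|X\<^sub>u \<times> X\<^sub>v|\<close>; the first description connects it to the metric, the
second to the area and to \<open>unit_normal_derivative\<close>.\<close>

lemma polar_jacobi_field:
  fixes X :: "real^2 \<Rightarrow> real^3" and r :: real and \<Psi> :: "real \<times> real \<Rightarrow> real^2"
  defines "D \<equiv> {0<..r} \<times> {0..2*pi}"
  defines "\<Psi>' \<equiv> \<lambda>q v. dir_deriv ({0<..r} \<times> {0..2*pi}) v \<Psi> q"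
  assumes C3: "C_k_on 3 unit_disc X" and imm: "immersion X" 
    and pol: "geodesic_polar_coords X r X0 \<Psi> P"
  obtains f g where "continuous_on D f" "continuous_on D g"
    and "\<And>\<rho> \<phi>. (\<rho>, \<phi>) \<in> D \<Longrightarrow> (f (\<rho>, \<phi>))\<^sup>2 = P \<rho> \<phi>"
    and "\<And>q. q \<in> D \<Longrightarrow> f q = (\<Psi>' q (1, 0) $ 1 * \<Psi>' q (0, 1) $ 2 - \<Psi>' q (1, 0) $ 2 * \<Psi>' q (0, 1) $ 1)
           * norm (cross3 (D_u X (\<Psi> q)) (D_v X (\<Psi> q)))"
    and "\<And>\<rho> \<phi>. 0 < \<rho> \<Longrightarrow> \<rho> < r \<Longrightarrow> \<phi> \<in> {0..2*pi} \<Longrightarrow>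
           ((\<lambda>t. f (t, \<phi>)) has_real_derivative g (\<rho>, \<phi>)) (at \<rho>)"
    and "\<And>\<rho> \<phi>. 0 < \<rho> \<Longrightarrow> \<rho> < r \<Longrightarrow> \<phi> \<in> {0..2*pi} \<Longrightarrow>
           ((\<lambda>t. g (t, \<phi>)) has_real_derivative - gauss_curvature X (\<Psi> (\<rho>, \<phi>)) * f (\<rho>, \<phi>)) (at \<rho>)"
proof -
  let ?e1 = "axis 1 1 :: real^2" and ?e2 = "axis 2 1 :: real^2"
  define \<Phi> where "\<Phi> = dir_deriv D (1, 0) \<Psi>"
  define \<Phi>' where "\<Phi>' q v = dir_deriv D v \<Phi> q" for q v
  define dX where "dX v = dir_deriv unit_disc v X" for v
  define ddX where "ddX v w = dir_deriv unit_disc w (dX v)" for v w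
  have X3: "C_k_on (Suc (Suc (Suc 0))) unit_disc X" using C3 by (simp add: numeral_3_eq_3)
  then have diff: "X differentiable_on unit_disc" by simp
  have X2: "C_k_on (Suc (Suc 0)) unit_disc (dX v)" for v using X3 by (simp add: dX_def)
  have X1: "C_k_on (Suc 0) unit_disc (ddX v w)" for v w using X2[of v] by (simp add: ddX_def)
  have X: "has_C1_derivative X (\<lambda>p v. dX v p) unit_disc"
    unfolding dX_def by (rule C_k_on_imp_has_C1_derivative[OF X3])
  have dX: "has_C1_derivative (dX v) (\<lambda>p w. ddX v w p) unit_disc"
    and ddX: "has_C1_derivative (ddX v w) (\<lambda>p u. dir_deriv unit_disc u (ddX v w) p) unit_disc" for v w
    unfolding ddX_def by (rule C_k_on_imp_has_C1_derivative[OF X2])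
      (rule C_k_on_imp_has_C1_derivative[OF X1[unfolded ddX_def]])
  have \<Psi>: "has_C1_derivative \<Psi> \<Psi>' D" and \<Phi>: "has_C1_derivative \<Phi> \<Phi>' D"
    using pol unfolding geodesic_polar_coords_def Let_def \<Psi>'_def \<Phi>'_def[abs_def] \<Phi>_def D_def One_nat_def
    by (auto intro!: C_k_on_imp_has_C1_derivative simp del: C_k_on.simps)
  have geo: "geodesic_on X {0..r} (\<lambda>\<rho>. \<Psi> (\<rho>, \<phi>))" if "\<phi> \<in> {0..2*pi}" for \<phi>
    using pol that by (auto simp: geodesic_polar_coords_def Let_def)
  have \<Psi>_disc: "\<Psi> ` D \<subseteq> unit_disc"
    using geo by (force simp: D_def geodesic_on_def)
  define c where "c p = cross3 (dX ?e1 p) (dX ?e2 p)" for p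
  obtain N' where N': "has_C1_derivative (unit_normal X) N' unit_disc"
    and K: "\<And>p. p \<in> unit_disc \<Longrightarrow> unit_normal X p \<bullet> cross3 (N' p ?e1) (N' p ?e2) = gauss_curvature X p * norm (c p)"
    using unit_normal_derivative[OF C3 imm] unfolding c_def dX_def D_u_def D_v_def by metis
  have c0: "c p \<noteq> 0" if "p \<in> unit_disc" for p
    using cross_partials_nonzero[OF imm diff that] by (simp add: c_def dX_def D_u_def D_v_def)
  have lin: "linear L" if "has_C1_derivative F F' unit_disc" "p \<in> unit_disc" "L = F' p" for F :: "real^2 \<Rightarrow> real^3" and F' p L
    using has_derivative_linear[OF has_C1_derivativeD(1)[OF that(1,2)]] that(3) by simp
  have vec2: "L w = w $ 1 *\<^sub>R L ?e1 + w $ 2 *\<^sub>R L ?e2" if "linear L" for L :: "real^2 \<Rightarrow> real^3" and w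
    by (rule linear_vec2[OF that])
  have cross_vec2: "cross3 (L v) (L w) = (v $ 1 * w $ 2 - v $ 2 * w $ 1) *\<^sub>R cross3 (L ?e1) (L ?e2)"
    if "linear L" for L :: "real^2 \<Rightarrow> real^3" and v w
    unfolding vec2[OF that, of v] vec2[OF that, of w]
    by (simp add: cross_add_left cross_add_right cross_mult_left cross_mult_right cross_skew[of "L ?e2" "L ?e1"] algebra_simps)
  define Y where "Y = X \<circ> \<Psi>"
  define Y' where "Y' q v = dX (\<Psi>' q v) (\<Psi> q)" for q v
  have Y: "has_C1_derivative Y Y' D"
    unfolding Y_def comp_def Y'_def by (rule has_C1_derivative_compose[OF X \<Psi> \<Psi>_disc])
  have Y_dir: "dir_deriv D v (X \<circ> \<Psi>) q = Y' q v" if "q \<in> D" for q v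
  proof -
    have "(Y has_derivative Y' q) (at q within D)" using has_C1_derivativeD(1)[OF Y that] .
    then have "(Y has_derivative frechet_derivative Y (at q within D)) (at q within D)"
      using frechet_derivative_works differentiable_def by blast
    from rect_derivative_unique[OF this[unfolded D_def] has_C1_derivativeD(1)[OF Y that, unfolded D_def]] that
    show ?thesis by (simp add: dir_deriv_def Y_def D_def)
  qed
  have pol_metric: "\<forall>\<rho>\<in>{0<..r}. \<forall>\<phi>\<in>{0..2*pi}.
       dir_deriv D (1, 0) (X \<circ> \<Psi>) (\<rho>, \<phi>) \<bullet> dir_deriv D (1, 0) (X \<circ> \<Psi>) (\<rho>, \<phi>) = 1
     \<and> dir_deriv D (1, 0) (X \<circ> \<Psi>) (\<rho>, \<phi>) \<bullet> dir_deriv D (0, 1) (X \<circ> \<Psi>) (\<rho>, \<phi>) = 0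
     \<and> dir_deriv D (0, 1) (X \<circ> \<Psi>) (\<rho>, \<phi>) \<bullet> dir_deriv D (0, 1) (X \<circ> \<Psi>) (\<rho>, \<phi>) = P \<rho> \<phi>"
    using pol unfolding geodesic_polar_coords_def Let_def D_def by (elim conjE)
  have metric: "Y' q (1, 0) \<bullet> Y' q (1, 0) = 1" "Y' q (1, 0) \<bullet> Y' q (0, 1) = 0"
      "Y' q (0, 1) \<bullet> Y' q (0, 1) = P (fst q) (snd q)" if "q \<in> D" for q
  proof -
    have "fst q \<in> {0<..r}" "snd q \<in> {0..2*pi}" using that by (auto simp: D_def)
    from pol_metric[THEN bspec, OF this(1), THEN bspec, OF this(2)]
    show "Y' q (1, 0) \<bullet> Y' q (1, 0) = 1" "Y' q (1, 0) \<bullet> Y' q (0, 1) = 0"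
      "Y' q (0, 1) \<bullet> Y' q (0, 1) = P (fst q) (snd q)"
      by (simp_all add: Y_dir[OF that])
  qed
  define n where "n q = unit_normal X (\<Psi> q)" for q
  define n' where "n' q v = N' (\<Psi> q) (\<Psi>' q v)" for q v
  have n: "has_C1_derivative n n' D"
    unfolding n_def[abs_def] n'_def[abs_def] by (rule has_C1_derivative_compose[OF N' \<Psi> \<Psi>_disc])
  have n_eq: "n q = sgn (c (\<Psi> q))" for q
    by (simp add: n_def unit_normal_def c_def dX_def D_u_def D_v_def)
  have nn: "n q \<bullet> n q = 1" if "q \<in> D" for q
    using c0[of "\<Psi> q"] that \<Psi>_disc by (auto simp: n_eq norm_sgn simp flip: norm_eq_1)
  have n_dX: "n q \<bullet> dX v (\<Psi> q) = 0" if "q \<in> D" for q v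
  proof -
    have "linear (\<lambda>v. dX v (\<Psi> q))" using lin[OF X] \<Psi>_disc that by blast
    from vec2[OF this, of v] show ?thesis
      by (simp add: n_eq sgn_div_norm c_def inner_add_right dot_cross_self)
  qed
  define T where "T q = \<Phi> q $ 1 *\<^sub>R dX ?e1 (\<Psi> q) + \<Phi> q $ 2 *\<^sub>R dX ?e2 (\<Psi> q)" for q
  define T' where "T' q v = 
     (\<Phi> q $ 1 *\<^sub>R ddX ?e1 (\<Psi>' q v) (\<Psi> q) + \<Phi>' q v $ 1 *\<^sub>R dX ?e1 (\<Psi> q)) +
     (\<Phi> q $ 2 *\<^sub>R ddX ?e2 (\<Psi>' q v) (\<Psi> q) + \<Phi>' q v $ 2 *\<^sub>R dX ?e2 (\<Psi> q))" for q v
  have \<Phi>i: "has_C1_derivative (\<lambda>q. \<Phi> q $ i) (\<lambda>q v. \<Phi>' q v $ i) D" for i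
    by (rule has_C1_derivative_bounded_linear[OF bounded_linear_vec_nth \<Phi>])
  note comp = has_C1_derivative_compose[OF _ \<Psi> \<Psi>_disc]
  note scale = has_C1_derivative_bilinear[OF bounded_bilinear_scaleR \<Phi>i]
  have T: "has_C1_derivative T T' D"
    unfolding T_def[abs_def] T'_def[abs_def]
    by (intro has_C1_derivative_add scale comp[OF dX])
  have YT: "Y' q (1, 0) = T q" if "q \<in> D" for q
  proof -
    have "linear (\<lambda>v. dX v (\<Psi> q))" using lin[OF X] \<Psi>_disc that by blast
    from vec2[OF this, of "\<Psi>' q (1, 0)"] show ?thesis
      by (simp add: Y'_def T_def \<Phi>_def \<Psi>'_def D_def)
  qed
  \<comment> \<open>The normal part of \<open>T\<^sub>\<rho>\<close> is that of \<open>S\<close>, as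
    the terms of \<open>T\<^sub>\<rho>\<close> with second derivatives of \<open>\<Psi>\<close> are
    tangential. Unlike \<open>T\<^sub>\<rho>\<close> itself, \<open>S\<close> is visibly of class
    \<open>C\<^sup>1\<close>.\<close>
  define S where "S q = 
      \<Phi> q $ 1 *\<^sub>R (\<Phi> q $ 1 *\<^sub>R ddX ?e1 ?e1 (\<Psi> q) + \<Phi> q $ 2 *\<^sub>R ddX ?e1 ?e2 (\<Psi> q)) +
      \<Phi> q $ 2 *\<^sub>R (\<Phi> q $ 1 *\<^sub>R ddX ?e2 ?e1 (\<Psi> q) + \<Phi> q $ 2 *\<^sub>R ddX ?e2 ?e2 (\<Psi> q))" for q
  define W where "W q = (n q \<bullet> S q) *\<^sub>R n q" for q
  obtain S' where S: "has_C1_derivative S S' D"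
  proof -
    note has_C1_derivative_add[OF scale[OF has_C1_derivative_add[OF scale[OF comp[OF ddX]] scale[OF comp[OF ddX]]], of 1]
        scale[OF has_C1_derivative_add[OF scale[OF comp[OF ddX]] scale[OF comp[OF ddX]]], of 2]]
    then show thesis using that unfolding S_def[abs_def] by blast
  qed
  obtain W' where W: "has_C1_derivative W W' D"
    using has_C1_derivative_bilinear[OF bounded_bilinear_scaleR
        has_C1_derivative_bilinear[OF bounded_bilinear_inner n S] n]
    unfolding W_def[abs_def] by blast
  have nT': "n q \<bullet> T' q (1, 0) = n q \<bullet> S q" if "q \<in> D" for q
  proof -
    have "linear (\<lambda>w. ddX v w (\<Psi> q))" for v using lin[OF dX] \<Psi>_disc that by blast
    from vec2[OF this, of _ "\<Phi> q"] show ?thesis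
      by (simp add: T'_def S_def inner_add_right n_dX[OF that] \<Psi>'_def \<Phi>_def[symmetric] D_def[symmetric])
  qed
  have normal: "a = (n q \<bullet> a) *\<^sub>R n q" if q: "q \<in> D" and a: "\<And>w. a \<bullet> dX w (\<Psi> q) = 0" for a q
  proof -
    define m where "m = a - (n q \<bullet> a) *\<^sub>R n q"
    have m: "m \<bullet> dX w (\<Psi> q) = 0" for w
      by (simp add: m_def inner_diff_left a n_dX[OF q])
    have "m \<bullet> n q = 0"
      using nn[OF q] by (simp add: m_def inner_diff_left inner_commute[of a])
    moreover have "c (\<Psi> q) = norm (c (\<Psi> q)) *\<^sub>R n q"
      using c0[of "\<Psi> q"] q \<Psi>_disc by (auto simp: n_eq sgn_div_norm)
    ultimately have "m \<bullet> c (\<Psi> q) = 0"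
      by (metis inner_scaleR_right mult_zero_right) 
    moreover have "cross3 m (c (\<Psi> q)) = (m \<bullet> dX ?e2 (\<Psi> q)) *\<^sub>R dX ?e1 (\<Psi> q) - (m \<bullet> dX ?e1 (\<Psi> q)) *\<^sub>R dX ?e2 (\<Psi> q)"
      by (simp add: c_def cross3_simps forall_3)
    ultimately have "m \<bullet> c (\<Psi> q) = 0" "cross3 m (c (\<Psi> q)) = 0"
      by (simp_all add: m)
    then have "m = 0" using norm_and_cross_eq_0 c0 q \<Psi>_disc by blast
    then show ?thesis by (simp add: m_def)
  qed
  have TW: "T' q (1, 0) = W q" if q: "q \<in> D" for q
  proof -
    obtain \<rho> \<phi> where q_eq: "q = (\<rho>, \<phi>)" and \<rho>: "0 < \<rho>" "\<rho> \<le> r" and \<phi>: "\<phi> \<in> {0..2*pi}"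
      using q by (auto simp: D_def)
    obtain v a where va: "\<And>t. t \<in> {0..r} \<Longrightarrow> ((\<lambda>s. X (\<Psi> (s, \<phi>))) has_vector_derivative v t) (at t within {0..r})"
      "\<And>t. t \<in> {0..r} \<Longrightarrow> (v has_vector_derivative a t) (at t within {0..r})"
      "\<And>t w. t \<in> {0..r} \<Longrightarrow> a t \<bullet> dX w (\<Psi> (t, \<phi>)) = 0"
      using geo[OF \<phi>] unfolding geodesic_on_def dX_def by metis
    \<comment> \<open>The interval \<open>{\<rho>/2..r}\<close> stays away from \<open>0\<close>,
      where \<open>T\<close> is not defined, and has positive length, which makes one-sided
      derivatives unique.\<close>
    have unique: "d = d'" if "(F has_vector_derivative d) (at t within {0..r})"
      "(F has_vector_derivative d') (at t within {\<rho>/2..r})" "t \<in> {\<rho>/2..r}" for F :: "real \<Rightarrow> real^3" and d d' t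
    proof -
      have "(F has_vector_derivative d) (at t within {\<rho>/2..r})"
        using \<rho> by (intro has_vector_derivative_within_subset[OF that(1)]) auto
      then show ?thesis
        using vector_derivative_unique_within_closed_interval[of "\<rho>/2" r t F d d'] that \<rho> by auto
    qed
    have inD: "(t, \<phi>) \<in> D" "{\<rho>/2..r} \<times> {\<phi>} \<subseteq> D" if "t \<in> {\<rho>/2..r}" for t
      using that \<rho> \<phi> by (auto simp: D_def)
    have vT: "v t = T (t, \<phi>)" if "t \<in> {\<rho>/2..r}" for t
    proof (rule unique[OF va(1) _ that])
      show "((\<lambda>s. X (\<Psi> (s, \<phi>))) has_vector_derivative T (t, \<phi>)) (at t within {\<rho>/2..r})"
        using has_vector_derivative_rho[OF has_C1_derivativeD(1)[OF Y inD(1)[OF that]] inD(2)[OF that]]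
        by (simp add: Y_def YT[OF inD(1)[OF that]])
    qed (use that \<rho> in auto)
    have \<rho>I: "\<rho> \<in> {\<rho>/2..r}" using \<rho> by auto
    have "a \<rho> = T' q (1, 0)"
    proof (rule unique[OF va(2) _ \<rho>I])
      have "((\<lambda>t. T (t, \<phi>)) has_vector_derivative T' q (1, 0)) (at \<rho> within {\<rho>/2..r})"
        unfolding q_eq by (rule has_vector_derivative_rho[OF has_C1_derivativeD(1)[OF T inD(1)[OF \<rho>I]] inD(2)[OF \<rho>I]])
      then show "(v has_vector_derivative T' q (1, 0)) (at \<rho> within {\<rho>/2..r})"
        by (rule has_vector_derivative_transform[rotated 2]) (use \<rho>I vT in auto)
    qed (use \<rho> in auto)
    then have "T' q (1, 0) \<bullet> dX w (\<Psi> q) = 0" for w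
      using va(3)[of \<rho>] \<rho> q_eq by auto
    from normal[OF q this] show ?thesis by (simp add: W_def nT'[OF q])
  qed
  define f where "f q = n q \<bullet> cross3 (T q) (Y' q (0, 1))" for q
  define g where "g q = T' q (0, 1) \<bullet> cross3 (n q) (T q)" for q
  have Wn: "W q = (n q \<bullet> W q) *\<^sub>R n q" if "q \<in> D" for q
    using nn[OF that] by (simp add: W_def)
  have Tn: "T q \<bullet> n q = 0" and Yn: "Y' q (0, 1) \<bullet> n q = 0" if "q \<in> D" for q
    using n_dX[OF that] YT[OF that] by (auto simp: inner_commute Y'_def simp flip: YT[OF that])
  have TT: "T q \<bullet> T q = 1" if "q \<in> D" for q using metric(1)[OF that] YT[OF that] by simp
  have f_det: "f q = (\<Psi>' q (1, 0) $ 1 * \<Psi>' q (0, 1) $ 2 - \<Psi>' q (1, 0) $ 2 * \<Psi>' q (0, 1) $ 1) * norm (c (\<Psi> q))"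
    if "q \<in> D" for q
  proof -
    have "linear (\<lambda>v. dX v (\<Psi> q))" using lin[OF X] \<Psi>_disc that by blast
    from cross_vec2[OF this, of "\<Psi>' q (1, 0)" "\<Psi>' q (0, 1)"] 
    have "f q = (\<Psi>' q (1, 0) $ 1 * \<Psi>' q (0, 1) $ 2 - \<Psi>' q (1, 0) $ 2 * \<Psi>' q (0, 1) $ 1) * (n q \<bullet> c (\<Psi> q))"
      by (simp add: f_def YT[OF that, symmetric] Y'_def c_def)
    moreover have "n q \<bullet> c (\<Psi> q) = norm (c (\<Psi> q))"
      by (cases "c (\<Psi> q) = 0") (auto simp: n_eq sgn_div_norm dot_square_norm power2_eq_square)
    ultimately show ?thesis by simp
  qed
  have f_sq: "(f q)\<^sup>2 = P (fst q) (snd q)" if "q \<in> D" for q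
  proof -
    have "cross3 (T q) (Y' q (0, 1)) = f q *\<^sub>R n q"
      unfolding f_def using nn[OF that] Tn[OF that] Yn[OF that]
      by (intro orthogonal_to_tangent_plane) (auto simp: norm_eq_1)
    then have "(f q)\<^sup>2 = cross3 (T q) (Y' q (0, 1)) \<bullet> cross3 (T q) (Y' q (0, 1))"
      using nn[OF that] by (simp add: power2_eq_square)
    also have "\<dots> = P (fst q) (snd q)"
      using metric[OF that] TT[OF that] YT[OF that] by (simp add: cross3_inner_cross3)
    finally show ?thesis .
  qed
  have contf: "continuous_on D f" and contg: "continuous_on D g"
    unfolding f_def[abs_def] g_def[abs_def]
    by (intro continuous_on_inner continuous_on_cross has_C1_derivativeD(2)[OF Y] has_C1_derivativeD(2)[OF T]
        has_C1_derivativeD(3)[OF n] has_C1_derivativeD(3)[OF T])+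
  have gK: "- (n q \<bullet> cross3 (n' q (1, 0)) (n' q (0, 1))) = - gauss_curvature X (\<Psi> q) * f q" if "q \<in> D" for q
  proof -
    have p: "\<Psi> q \<in> unit_disc" using \<Psi>_disc that by blast
    show ?thesis
      using cross_vec2[OF lin[OF N' p refl], of "\<Psi>' q (1, 0)" "\<Psi>' q (0, 1)"] K[OF p] f_det[OF that]
      by (simp add: n'_def n_def)
  qed
  show thesis
  proof (rule that[of f g])
    fix \<rho> \<phi> assume *: "0 < \<rho>" "\<rho> < r" "\<phi> \<in> {0..2*pi}"
    show "((\<lambda>t. f (t, \<phi>)) has_real_derivative g (\<rho>, \<phi>)) (at \<rho>)"
      unfolding f_def g_def
      by (rule jacobi_equation_frame(1)[where r = r, folded D_def, OF has_C1_derivativeD(1)[OF Y] T n W YT TW Wn nn TT Tn Yn *])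
    have inD: "(\<rho>, \<phi>) \<in> D" using * by (auto simp: D_def)
    show "((\<lambda>t. g (t, \<phi>)) has_real_derivative - gauss_curvature X (\<Psi> (\<rho>, \<phi>)) * f (\<rho>, \<phi>)) (at \<rho>)"
      unfolding gK[OF inD, symmetric] unfolding g_def
      by (intro jacobi_equation_frame(2)[where r = r, folded D_def, OF has_C1_derivativeD(1)[OF Y] T n W YT TW Wn nn TT Tn Yn *])
  qed (use contf contg f_sq f_det in \<open>auto simp: c_def dX_def D_u_def D_v_def\<close>)
qed

section \<open>The area estimate\<close>

lemma continuous_on_constant_sign:
  fixes f :: "real \<Rightarrow> real"
  assumes "continuous_on S f" "connected S" "\<And>x. x \<in> S \<Longrightarrow> f x \<noteq> 0"
  obtains \<sigma> where "\<sigma> = 1 \<or> \<sigma> = -1" "\<And>x. x \<in> S \<Longrightarrow> \<bar>f x\<bar> = \<sigma> * f x"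
proof (cases "\<exists>x\<in>S. f x > 0")
  case True
  then obtain a where a: "a \<in> S" "f a > 0" by blast
  have "f x > 0" if "x \<in> S" for x
  proof (rule ccontr)
    assume "\<not> f x > 0"
    then have "0 \<in> f ` S"
      using a that connectedD_interval[OF connected_continuous_image[OF assms(1,2)], of "f x" "f a" 0] by auto
    then show False using assms(3) by force
  qed
  then show ?thesis using that[of 1] by force
next
  case False
  then show ?thesis using that[of "-1"] by force
qed

theorem mainTheorem2:
  fixes X :: "real^2 \<Rightarrow> real^3" and X0 :: "real^3" and r K0 :: real
    and \<Psi> :: "real \<times> real \<Rightarrow> real^2" and P :: "real \<Rightarrow> real \<Rightarrow> real"
  assumes "C_k_on 3 unit_disc X"
    and "immersion X"
    and "r > 0"
    and "geodesic_polar_coords X r X0 \<Psi> P"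
    and "K0 \<ge> 0"
    and "\<forall>\<rho>\<in>{0..r}. \<forall>\<phi>\<in>{0..2*pi}. gauss_curvature X (\<Psi> (\<rho>, \<phi>)) \<le> K0"
  shows "surface_area X \<le> r\<^sup>2 * (pi + 1/2 *
           integral {0..r} (\<lambda>\<rho>. integral {0..2*pi} (\<lambda>\<phi>.
             (K0 - gauss_curvature X (\<Psi> (\<rho>, \<phi>))) * sqrt (P \<rho> \<phi>))))"
proof -
  note pol = assms(4)
  define D where "D = {0<..r} \<times> {0..2*pi}"
  let ?B = "{0..r} \<times> {0..2*pi}"
  have box: "cbox (0, 0) (r, 2*pi) = ?B" by (simp add: cbox_Pair_eq)
  define K where "K \<rho> \<phi> = gauss_curvature X (\<Psi> (\<rho>, \<phi>))" for \<rho> \<phi>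
  define w where "w p = norm (cross3 (D_u X p) (D_v X p))" for p
  define \<Psi>' where "\<Psi>' q v = dir_deriv D v \<Psi> q" for q v
  obtain p where bij: "bij_betw \<Psi> ({0<..r} \<times> {0..<2*pi}) (unit_disc - {p})"
    using pol unfolding geodesic_polar_coords_def Let_def by blast
  have cont\<Psi>: "continuous_on ?B \<Psi>" and C1\<Psi>: "C_k_on 1 D \<Psi>"
    and geo: "\<forall>\<phi>\<in>{0..2*pi}. geodesic_on X {0..r} (\<lambda>\<rho>. \<Psi> (\<rho>, \<phi>))"
    and Ppos: "\<forall>\<rho>\<in>{0<..r}. \<forall>\<phi>\<in>{0..<2*pi}. P \<rho> \<phi> > 0"
    and lim: "\<forall>\<phi>\<in>{0..<2*pi}. ((\<lambda>\<rho>. P \<rho> \<phi>) \<longlongrightarrow> 0) (at_right 0)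
             \<and> (deriv (\<lambda>\<rho>. sqrt (P \<rho> \<phi>)) \<longlongrightarrow> 1) (at_right 0)"
    using pol unfolding geodesic_polar_coords_def Let_def D_def by - (elim conjE, assumption)+
  have d\<Psi>: "(\<Psi> has_derivative \<Psi>' q) (at q within D)" if "q \<in> D" for q
    using has_C1_derivativeD(1)[OF C_k_on_imp_has_C1_derivative[OF C1\<Psi>[unfolded One_nat_def]] that]
    by (simp add: \<Psi>'_def[abs_def])
  obtain f g where contf: "continuous_on D f" and contg: "continuous_on D g"
    and f_sq: "\<And>\<rho> \<phi>. (\<rho>, \<phi>) \<in> D \<Longrightarrow> (f (\<rho>, \<phi>))\<^sup>2 = P \<rho> \<phi>"
    and f_det: "\<And>q. q \<in> D \<Longrightarrow> f q = (\<Psi>' q (1, 0) $ 1 * \<Psi>' q (0, 1) $ 2 - \<Psi>' q (1, 0) $ 2 * \<Psi>' q (0, 1) $ 1) * w (\<Psi> q)"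
    and df: "\<And>\<rho> \<phi>. 0 < \<rho> \<Longrightarrow> \<rho> < r \<Longrightarrow> \<phi> \<in> {0..2*pi} \<Longrightarrow>
           ((\<lambda>t. f (t, \<phi>)) has_real_derivative g (\<rho>, \<phi>)) (at \<rho>)"
    and dg: "\<And>\<rho> \<phi>. 0 < \<rho> \<Longrightarrow> \<rho> < r \<Longrightarrow> \<phi> \<in> {0..2*pi} \<Longrightarrow>
           ((\<lambda>t. g (t, \<phi>)) has_real_derivative - K \<rho> \<phi> * f (\<rho>, \<phi>)) (at \<rho>)"
  proof (rule polar_jacobi_field[OF assms(1,2) pol, folded D_def, folded \<Psi>'_def w_def K_def], goal_cases)
    case (1 f g)
    show ?case by (rule 1(1)[OF 1(2-)])
  qed
  have sqrtP: "sqrt (P \<rho> \<phi>) = \<bar>f (\<rho>, \<phi>)\<bar>" if "(\<rho>, \<phi>) \<in> D" for \<rho> \<phi>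
    using f_sq[OF that] by (metis real_sqrt_abs)
  have contK: "continuous_on ?B (\<lambda>(\<rho>, \<phi>). K \<rho> \<phi>)"
  proof -
    obtain N' where "continuous_on unit_disc (gauss_curvature X)"
      using unit_normal_derivative[OF assms(1,2)] .
    then have "continuous_on ?B (\<lambda>q. gauss_curvature X (\<Psi> q))"
      by (rule continuous_on_compose2[OF _ cont\<Psi>]) (use geo in \<open>auto simp: geodesic_on_def\<close>)
    then show ?thesis by (simp add: K_def split_beta)
  qed
  obtain M where M: "\<bar>K \<rho> \<phi>\<bar> \<le> M" if "\<rho> \<in> {0..r}" "\<phi> \<in> {0..2*pi}" for \<rho> \<phi>
  proof -
    have "bounded ((\<lambda>(\<rho>, \<phi>). K \<rho> \<phi>) ` ?B)"
      by (intro compact_imp_bounded compact_continuous_image contK compact_Times compact_Icc)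
    then show thesis using that by (force simp: bounded_real)
  qed
  define C where "C = exp ((1 + M) * r)"
  \<comment> \<open>The value at \<open>\<rho> = 0\<close> is the continuous extension; there
    \<open>f\<close> and \<open>P\<close> are arbitrary.\<close>
  define s where "s \<rho> \<phi> = (if \<rho> = 0 then 0 else \<bar>f (\<rho>, \<phi>)\<bar>)" for \<rho> \<phi>
  have s_nonneg: "s \<rho> \<phi> \<ge> 0" for \<rho> \<phi> by (simp add: s_def)
  have radial: "((\<lambda>t. s t \<phi> + (r - t)\<^sup>2 / 2 * (K t \<phi> * s t \<phi>)) has_integral r\<^sup>2 / 2) {0..r}" (is ?int)
    "\<And>t. 0 < t \<Longrightarrow> t \<le> r \<Longrightarrow> s t \<phi> \<le> C * t" if \<phi>: "\<phi> \<in> {0..<2*pi}" for \<phi>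
  proof -
    have \<phi>': "\<phi> \<in> {0..2*pi}" using \<phi> by auto
    have inD: "(t, \<phi>) \<in> D" if "t \<in> {0<..r}" for t using that \<phi>' by (simp add: D_def)
    have cont: "continuous_on {0<..r} (\<lambda>t. h (t, \<phi>))" if "continuous_on D h" for h :: "_ \<Rightarrow> real"
      by (rule continuous_on_compose2[OF that])
         (auto simp: inD intro!: continuous_on_Pair continuous_on_const continuous_on_id)
    have "f (t, \<phi>) \<noteq> 0" if "t \<in> {0<..r}" for t
      using Ppos that \<phi> f_sq[OF inD[OF that]] by fastforce
    then obtain \<sigma> where \<sigma>: "\<And>t. t \<in> {0<..r} \<Longrightarrow> \<bar>f (t, \<phi>)\<bar> = \<sigma> * f (t, \<phi>)"
      using continuous_on_constant_sign[OF cont[OF contf]] connected_Ioc by metis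
    define F G where "F t = \<sigma> * f (t, \<phi>)" and "G t = \<sigma> * g (t, \<phi>)" for t
    have dF: "(F has_real_derivative G t) (at t)" and dG: "(G has_real_derivative - K t \<phi> * F t) (at t)"
      if "0 < t" "t < r" for t
      unfolding F_def G_def
      by (auto intro!: derivative_eq_intros df dg that \<phi>')
    have PF: "sqrt (P t \<phi>) = F t" if "t \<in> {0<..r}" for t
      using sqrtP[OF inD[OF that]] \<sigma>[OF that] by (simp add: F_def)
    have near: "\<forall>\<^sub>F t in at_right 0. t \<in> {0<..<r}"
      using \<open>r > 0\<close> by (rule eventually_at_right_real)
    have limF: "(F \<longlongrightarrow> 0) (at_right 0)"
    proof -
      have "((\<lambda>t. sqrt (P t \<phi>)) \<longlongrightarrow> sqrt 0) (at_right 0)"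
        using lim \<phi> by (intro tendsto_real_sqrt) auto
      moreover have "\<forall>\<^sub>F t in at_right 0. sqrt (P t \<phi>) = F t"
        using near by (rule eventually_mono) (auto simp: PF)
      ultimately show ?thesis by (simp add: Lim_transform_eventually)
    qed
    have limG: "(G \<longlongrightarrow> 1) (at_right 0)"
    proof -
      have "deriv (\<lambda>\<rho>. sqrt (P \<rho> \<phi>)) t = G t" if "t \<in> {0<..<r}" for t
      proof (rule DERIV_imp_deriv)
        show "((\<lambda>\<rho>. sqrt (P \<rho> \<phi>)) has_real_derivative G t) (at t)"
          by (rule has_field_derivative_transform_within_open[OF dF, of _ "{0<..<r}"]) (use that PF in auto)
      qed
      then have "\<forall>\<^sub>F t in at_right 0. deriv (\<lambda>\<rho>. sqrt (P \<rho> \<phi>)) t = G t"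
        using near by (rule eventually_mono[rotated])
      then show ?thesis using lim \<phi> by (auto intro: Lim_transform_eventually)
    qed
    note ode = \<open>r > 0\<close> dF dG cont[OF contf, THEN continuous_on_mult_left, of \<sigma>, folded F_def]
      cont[OF contg, THEN continuous_on_mult_left, of \<sigma>, folded G_def] limF limG
    have sF: "s t \<phi> = F t" if "t \<in> {0<..r}" for t
      using \<sigma>[OF that] that by (simp add: s_def F_def)
    have "((\<lambda>t. F t + (r - t)\<^sup>2 / 2 * (K t \<phi> * F t)) has_integral r\<^sup>2 / 2) {0..r}"
      by (rule jacobi_equation_integral) (use ode in auto)
    then show ?int
      by (rule has_integral_spike_finite[of "{0}", rotated 2]) (auto simp: sF)
    show "s t \<phi> \<le> C * t" if "0 < t" "t \<le> r" for t
      using jacobi_equation_bound[of r F G "\<lambda>t. K t \<phi>" M t] ode M \<phi>' that by (auto simp: sF C_def)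
  qed
  have s_le: "s t \<phi> \<le> C * t" if "t \<in> {0..r}" "\<phi> \<in> {0..2*pi}" for t \<phi>
  proof (cases "t = 0")
    case False
    then have t: "0 < t" "t \<le> r" using that by auto
    \<comment> \<open>The estimate is known for \<open>\<phi> < 2*pi\<close> only, since at
      \<open>\<phi> = 2*pi\<close> neither the positivity of \<open>P\<close> nor its limits at the
      centre are given.\<close>
    have cl: "closure {0..<2*pi} = {0..2*pi}" by (simp add: closure_atLeastLessThan)
    have "continuous_on {0..2*pi} (\<lambda>\<phi>. f (t, \<phi>))"
      by (rule continuous_on_compose2[OF contf])
         (use t in \<open>auto simp: D_def intro!: continuous_on_Pair continuous_on_const continuous_on_id\<close>)
    then have "continuous_on (closure {0..<2*pi}) (s t)"
      unfolding cl s_def using False by (auto intro!: continuous_intros)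
    from continuous_le_on_closure[OF this, of \<phi> "C * t"] that(2) show ?thesis
      using radial(2) t by (simp add: cl)
  qed (simp add: s_def)
  have conts: "continuous_on ?B (\<lambda>(\<rho>, \<phi>). s \<rho> \<phi>)"
    unfolding continuous_on_def
  proof
    fix q assume q: "q \<in> ?B"
    show "((\<lambda>(\<rho>, \<phi>). s \<rho> \<phi>) \<longlongrightarrow> (case q of (\<rho>, \<phi>) \<Rightarrow> s \<rho> \<phi>)) (at q within ?B)"
    proof (cases "fst q = 0")
      case True
      have "((\<lambda>(\<rho>, \<phi>). s \<rho> \<phi>) \<longlongrightarrow> 0) (at q within ?B)"
      proof (rule Lim_null_comparison)
        show "\<forall>\<^sub>F z in at q within ?B. norm (case z of (\<rho>, \<phi>) \<Rightarrow> s \<rho> \<phi>) \<le> C * fst z"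
          unfolding eventually_at_filter
          by (rule always_eventually) (use s_le s_nonneg in auto)
        have "((\<lambda>z. C * fst z) \<longlongrightarrow> C * fst q) (at q within ?B)" by (intro tendsto_intros)
        then show "((\<lambda>z. C * fst z) \<longlongrightarrow> 0) (at q within ?B)" using True by simp
      qed
      then show ?thesis using True by (simp add: split_beta s_def)
    next
      case False
      then have qD: "q \<in> D" using q by (auto simp: D_def)
      have "at q within ?B = at q within D"
        using qD by (intro at_within_nhd[of _ "{0<..} \<times> UNIV"]) (auto simp: D_def open_Times)
      moreover have "continuous_on D (\<lambda>(\<rho>, \<phi>). s \<rho> \<phi>)"
        by (rule continuous_on_eq[OF continuous_on_rabs[OF contf]]) (auto simp: s_def D_def)
      ultimately show ?thesis using qD by (simp add: continuous_on_def)
    qed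
  qed
  have area: "surface_area X = integral (cbox (0, 0) (r, 2*pi)) (\<lambda>(\<rho>, \<phi>). s \<rho> \<phi>)"
    unfolding surface_area_def
  proof (rule polar_change_of_variables[OF _ bij])
    show "(\<Psi> has_derivative \<Psi>' q) (at q within {0<..r} \<times> {0..2*pi})" if "q \<in> {0<..r} \<times> {0..2*pi}" for q
      using d\<Psi> that by (simp add: D_def)
    show "(case q of (\<rho>, \<phi>) \<Rightarrow> s \<rho> \<phi>) = \<bar>\<Psi>' q (1, 0) $ 1 * \<Psi>' q (0, 1) $ 2 - \<Psi>' q (1, 0) $ 2 * \<Psi>' q (0, 1) $ 1\<bar> *
        norm (cross3 (D_u X (\<Psi> q)) (D_v X (\<Psi> q)))" if "q \<in> {0<..r} \<times> {0..2*pi}" for q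
    proof -
      have "(case q of (\<rho>, \<phi>) \<Rightarrow> s \<rho> \<phi>) = \<bar>f q\<bar>" using that by (auto simp: s_def)
      then show ?thesis using f_det[of q] that by (simp add: D_def abs_mult w_def)
    qed
  qed (use conts box in auto)
  define G where "G \<rho> \<phi> = s \<rho> \<phi> - r\<^sup>2 / 2 * ((K0 - K \<rho> \<phi>) * s \<rho> \<phi>)" for \<rho> \<phi>
  have contKs: "continuous_on ?B (\<lambda>(\<rho>, \<phi>). (K0 - K \<rho> \<phi>) * s \<rho> \<phi>)"
    using conts contK unfolding split_beta by (intro continuous_intros)
  have contG: "continuous_on ?B (\<lambda>(\<rho>, \<phi>). G \<rho> \<phi>)"
    using conts contK unfolding split_beta G_def by (intro continuous_intros)
  have slice: "(\<lambda>\<rho>. h \<rho> \<phi>) integrable_on {0..r}"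
    if "continuous_on ?B (\<lambda>(\<rho>, \<phi>). h \<rho> \<phi>)" "\<phi> \<in> {0..2*pi}" for h :: "real \<Rightarrow> real \<Rightarrow> real" and \<phi>
    by (intro integrable_continuous_real continuous_on_compose2[OF that(1), of _ "\<lambda>\<rho>. (\<rho>, \<phi>)", simplified])
       (use that(2) in \<open>auto intro!: continuous_on_Pair continuous_on_const continuous_on_id\<close>)
  have contG': "continuous_on ({0..2*pi} \<times> {0..r}) (\<lambda>(\<phi>, \<rho>). G \<rho> \<phi>)"
    using swap_continuous[of 0 0 r "2*pi" G] contG by (simp add: cbox_Pair_eq)
  have G_le: "integral {0..r} (\<lambda>\<rho>. G \<rho> \<phi>) \<le> r\<^sup>2 / 2" if \<phi>: "\<phi> \<in> {0..<2*pi}" for \<phi>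
  proof (rule has_integral_le[OF integrable_integral[OF slice[OF contG]] radial(1)[OF \<phi>]])
    fix t assume t: "t \<in> {0..r}"
    have "(r - t)\<^sup>2 \<le> r\<^sup>2" using t by (intro power_mono) auto
    moreover note s_nonneg[of t \<phi>]
    moreover have "K t \<phi> \<le> K0" using assms(6) t \<phi> by (auto simp: K_def)
    ultimately have "(r - t)\<^sup>2 * ((K0 - K t \<phi>) * s t \<phi>) \<le> r\<^sup>2 * ((K0 - K t \<phi>) * s t \<phi>)"
      by (intro mult_right_mono) auto
    moreover have "(r - t)\<^sup>2 * (K0 * s t \<phi>) \<ge> 0" using s_nonneg assms(5) by auto
    ultimately show "G t \<phi> \<le> s t \<phi> + (r - t)\<^sup>2 / 2 * (K t \<phi> * s t \<phi>)"
      by (simp add: G_def algebra_simps)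
  qed (use \<phi> in auto)
  have G_le': "integral {0..r} (\<lambda>\<rho>. G \<rho> \<phi>) \<le> r\<^sup>2 / 2" if "\<phi> \<in> {0..2*pi}" for \<phi>
  proof -
    have cl: "closure {0..<2*pi} = {0..2*pi}" by (simp add: closure_atLeastLessThan)
    have "continuous_on ({0..2*pi} \<times> cbox 0 r) (\<lambda>(\<phi>, \<rho>). G \<rho> \<phi>)"
      using contG' by simp
    from integral_continuous_on_param[OF this]
    have "continuous_on (closure {0..<2*pi}) (\<lambda>\<phi>. integral {0..r} (\<lambda>\<rho>. G \<rho> \<phi>))"
      by (simp add: cl)
    from continuous_le_on_closure[OF this, of \<phi> "r\<^sup>2 / 2"] that G_le show ?thesis
      by (simp add: cl)
  qed
  have "integral {0..r} (\<lambda>\<rho>. integral {0..2*pi} (\<lambda>\<phi>. G \<rho> \<phi>)) 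
      = integral {0..2*pi} (\<lambda>\<phi>. integral {0..r} (\<lambda>\<rho>. G \<rho> \<phi>))"
    using integral_swap_continuous[of 0 0 r "2*pi" G] contG box by simp
  also have "\<dots> \<le> integral {0..2*pi} (\<lambda>\<phi>. r\<^sup>2 / 2)"
  proof (rule integral_le)
    show "(\<lambda>\<phi>. integral {0..r} (\<lambda>\<rho>. G \<rho> \<phi>)) integrable_on {0..2*pi}"
      using integral_integrable_2dim[of 0 0 "2*pi" r "\<lambda>(\<phi>, \<rho>). G \<rho> \<phi>"] contG'
      by (simp add: cbox_Pair_eq)
  qed (use G_le' in auto)
  also have "\<dots> = r\<^sup>2 * pi" by simp
  finally have G_total: "integral ?B (\<lambda>(\<rho>, \<phi>). G \<rho> \<phi>) \<le> r\<^sup>2 * pi"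
    using integral_prod_continuous[of 0 0 r "2*pi" "\<lambda>(\<rho>, \<phi>). G \<rho> \<phi>"] contG box by simp
  have "integral ?B (\<lambda>(\<rho>, \<phi>). (K0 - K \<rho> \<phi>) * s \<rho> \<phi>)
      = integral {0..r} (\<lambda>\<rho>. integral {0..2*pi} (\<lambda>\<phi>. (K0 - K \<rho> \<phi>) * s \<rho> \<phi>))"
    using integral_prod_continuous[of 0 0 r "2*pi" "\<lambda>(\<rho>, \<phi>). (K0 - K \<rho> \<phi>) * s \<rho> \<phi>"] contKs box by simp
  also have "\<dots> = integral {0..r} (\<lambda>\<rho>. integral {0..2*pi} (\<lambda>\<phi>. (K0 - K \<rho> \<phi>) * sqrt (P \<rho> \<phi>)))"
    by (intro integral_spike[of "{0}"] integral_cong) (auto simp: s_def sqrtP D_def)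
  finally have rhs: "integral ?B (\<lambda>(\<rho>, \<phi>). (K0 - K \<rho> \<phi>) * s \<rho> \<phi>) 
      = integral {0..r} (\<lambda>\<rho>. integral {0..2*pi} (\<lambda>\<phi>. (K0 - K \<rho> \<phi>) * sqrt (P \<rho> \<phi>)))" .
  have int: "(\<lambda>(\<rho>, \<phi>). s \<rho> \<phi>) integrable_on ?B" "(\<lambda>(\<rho>, \<phi>). (K0 - K \<rho> \<phi>) * s \<rho> \<phi>) integrable_on ?B"
    using conts contKs integrable_continuous unfolding box[symmetric] by blast+
  have "integral ?B (\<lambda>(\<rho>, \<phi>). G \<rho> \<phi>)
      = integral ?B (\<lambda>(\<rho>, \<phi>). s \<rho> \<phi>) - r\<^sup>2 / 2 * integral ?B (\<lambda>(\<rho>, \<phi>). (K0 - K \<rho> \<phi>) * s \<rho> \<phi>)"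
    using integral_diff[OF int(1) integrable_on_mult_right[OF int(2), of "r\<^sup>2 / 2"]]
    by (simp add: G_def case_prod_unfold)
  with G_total have "surface_area X \<le> r\<^sup>2 * pi + r\<^sup>2 / 2 * integral ?B (\<lambda>(\<rho>, \<phi>). (K0 - K \<rho> \<phi>) * s \<rho> \<phi>)"
    by (simp add: area box)
  from this[unfolded rhs, unfolded K_def] show ?thesis
    by (simp add: distrib_left)
qed

end
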